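(* Let $\gamma>0$, let $\mathcal Z\subseteq\mathbb R^d$ be a nonempty compact convex set, and suppose that $\|\bm y\|_2\le r$ for all $\bm y\in\mathcal Y$. Let $\mathcal G$ be a class of measurable predictors $\bm g:\mathcal X\to\mathbb R^d$, let $\{(\bm x_i,\bm y_i)\}_{i=1}^N$ be i.i.d. from $\mathbb P$, and let $\widehat{\bm g}_{\rm RSPO}\in\operatorname{argmin}_{\bm g\in\mathcal G}\widehat R(\bm g)$ (assumed to exist). Then, for any $\delta\in(0,1)$, with probability at least $1-\delta$, $$R(\widehat{\bm g}_{\rm RSPO})-R^\star(\mathcal G)\ \le\ \frac{4\sqrt2\,r}{\gamma}\,\mathfrak R_d(\mathcal G)+b\sqrt{\frac{2\log(2/\delta)}{N}}.$$
   Context: $(\bm x,\bm y)\sim\mathbb P$ on $\mathcal X\times\mathcal Y$, $\mathcal X\subseteq\mathbb R^p$, $\mathcal Y\subseteq\mathbb R^d$. $v^\star(\bm y)=\min_{\bm z\in\mathcal Z}\bm y^\top\bm z$; $\bm z^\star_\gamma(\bm y)$ is the unique minimizer of $\bm y^\top\bm z+\frac{\gamma}{2}\|\bm z\|_2^2$ over $\bm z\in\mathcal Z$; $\ell_{\mathcal{RSPO}}(\hat{\bm y},\bm y)=\bm y^\top\bm z^\star_\gamma(\hat{\bm y})-v^\star(\bm y)$. $R(\bm g)=\mathbb E_{\mathbb P}[\ell_{\mathcal{RSPO}}(\bm g(\bm x),\bm y)]$, $\widehat R(\bm g)=\frac1N\sum_{i=1}^N\ell_{\mathcal{RSPO}}(\bm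 g(\bm x_i),\bm y_i)$, $R^\star(\mathcal G)=\inf_{\bm g\in\mathcal G}R(\bm g)$. $b=\sup_{\bm y\in\mathcal Y}\{\max_{\bm z\in\mathcal Z}\bm y^\top\bm z-\min_{\bm z\in\mathcal Z}\bm y^\top\bm z\}$, assumed finite. Multivariate Rademacher complexity: $\mathfrak R_d(\mathcal G)=\mathbb E\big[\sup_{\bm g\in\mathcal G}\frac1N\sum_{i=1}^N\bm\sigma_i^\top\bm g(\bm x_i)\big]$, where $\bm\sigma_1,\dots,\bm\sigma_N$ are independent and uniform on $\{+1,-1\}^d$, independent of the i.i.d. sample $\bm x_1,\dots,\bm x_N$, and the expectation is over both.
   Formalization: It is additionally assumed that the suprema over the class G of the sign-weighted sample averages, both of the predictors and of the induced losses, are measurable; without such a condition the Rademacher complexity of G can be undefined. *)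

theory Defs
  imports "HOL-Probability.Probability"
begin

definition opt_value :: "(real^'d) set \<Rightarrow> real^'d \<Rightarrow> real" where
  "opt_value Z y = (INF z\<in>Z. y \<bullet> z)"

definition reg_solution :: "(real^'d) set \<Rightarrow> real \<Rightarrow> real^'d \<Rightarrow> real^'d" where
  "reg_solution Z \<gamma> y =
     (THE z. is_arg_min (\<lambda>z. y \<bullet> z + \<gamma> / 2 * (norm z)\<^sup>2) (\<lambda>z. z \<in> Z) z)"

definition rspo_loss :: "(real^'d) set \<Rightarrow> real \<Rightarrow> real^'d \<Rightarrow> real^'d \<Rightarrow> real" where
  "rspo_loss Z \<gamma> yhat y = y \<bullet> reg_solution Z \<gamma> yhat - opt_value Z y"

definition cost_range :: "(real^'d) set \<Rightarrow> real^'d \<Rightarrow> real" where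
  "cost_range Z y = (SUP z\<in>Z. y \<bullet> z) - (INF z\<in>Z. y \<bullet> z)"

definition loss_bound :: "(real^'d) set \<Rightarrow> (real^'d) set \<Rightarrow> real" where
  "loss_bound Z Y = (SUP y\<in>Y. cost_range Z y)"

definition risk :: "(real^'d) set \<Rightarrow> real \<Rightarrow> ((real^'p) \<times> (real^'d)) measure
    \<Rightarrow> (real^'p \<Rightarrow> real^'d) \<Rightarrow> real" where
  "risk Z \<gamma> P g = (LINT xy|P. rspo_loss Z \<gamma> (g (fst xy)) (snd xy))"

definition emp_risk :: "(real^'d) set \<Rightarrow> real \<Rightarrow> nat \<Rightarrow> (nat \<Rightarrow> (real^'p) \<times> (real^'d))
    \<Rightarrow> (real^'p \<Rightarrow> real^'d) \<Rightarrow> real" where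
  "emp_risk Z \<gamma> N s g = (1 / real N) * (\<Sum>i<N. rspo_loss Z \<gamma> (g (fst (s i))) (snd (s i)))"

definition best_risk :: "(real^'d) set \<Rightarrow> real \<Rightarrow> ((real^'p) \<times> (real^'d)) measure
    \<Rightarrow> (real^'p \<Rightarrow> real^'d) set \<Rightarrow> real" where
  "best_risk Z \<gamma> P G = (INF g\<in>G. risk Z \<gamma> P g)"

definition input_law :: "(real^'p) set \<Rightarrow> ((real^'p) \<times> (real^'d)) measure \<Rightarrow> (real^'p) measure" where
  "input_law X P = distr P (restrict_space borel X) fst"

(* Expectation with values in the extended reals, so that an infinite mean is
   infinity instead of the value 0 that the Bochner integral would return.
   e2ennreal truncates negative arguments to 0.  If both parts are infinite the
   mean does not exist; the value is then infinity (as infinity - infinity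
   is infinity on type ereal). *)
definition ereal_expectation :: "'a measure \<Rightarrow> ('a \<Rightarrow> ereal) \<Rightarrow> ereal" where
  "ereal_expectation M f =
     enn2ereal (\<integral>\<^sup>+ x. e2ennreal (f x) \<partial>M) - enn2ereal (\<integral>\<^sup>+ x. e2ennreal (- f x) \<partial>M)"

definition sign_vectors :: "(real^'d) set" where
  "sign_vectors = {v. \<forall>j. v $ j \<in> {-1, 1}}"

(* Joint law of the sample x_0, ..., x_{N-1}, i.i.d. from D, and of the independent
   sign vectors. *)
definition rademacher_space :: "nat \<Rightarrow> (real^'p) measure
    \<Rightarrow> ((nat \<Rightarrow> real^'p) \<times> (nat \<Rightarrow> real^'d)) measure" where
  "rademacher_space N D =
     (\<Pi>\<^sub>M i\<in>{..<N}. D) \<Otimes>\<^sub>M (\<Pi>\<^sub>M i\<in>{..<N}. uniform_count_measure sign_vectors)"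

definition rademacher_sup :: "nat \<Rightarrow> (real^'p \<Rightarrow> real^'d) set
    \<Rightarrow> (nat \<Rightarrow> real^'p) \<times> (nat \<Rightarrow> real^'d) \<Rightarrow> ereal" where
  "rademacher_sup N G = (\<lambda>(x, \<sigma>). SUP g\<in>G. ereal ((1 / real N) * (\<Sum>i<N. \<sigma> i \<bullet> g (x i))))"

definition rademacher_complexity :: "nat \<Rightarrow> (real^'p) measure \<Rightarrow> (real^'p \<Rightarrow> real^'d) set \<Rightarrow> ereal" where
  "rademacher_complexity N D G = ereal_expectation (rademacher_space N D) (rademacher_sup N G)"

(* Measurability of the suprema over a possibly uncountable class.  The first
   conjunct makes the expectation in rademacher_complexity meaningful, the second
   does the same for the Rademacher averages of the induced class of losses.
   Both hold, for instance, whenever G has a countable subset that is dense for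
   pointwise convergence of sequences. *)
definition measurable_suprema :: "(real^'d) set \<Rightarrow> real \<Rightarrow> nat \<Rightarrow> (real^'p) set
    \<Rightarrow> ((real^'p) \<times> (real^'d)) measure \<Rightarrow> (real^'p \<Rightarrow> real^'d) set \<Rightarrow> bool" where
  "measurable_suprema Z \<gamma> N X P G \<longleftrightarrow>
     rademacher_sup N G \<in> borel_measurable (rademacher_space N (input_law X P)) \<and>
     (\<forall>\<epsilon>\<in>{..<N} \<rightarrow>\<^sub>E {-1, 1 :: real}.
        (\<lambda>s. SUP g\<in>G. ereal ((1 / real N) *
           (\<Sum>i<N. \<epsilon> i * rspo_loss Z \<gamma> (g (fst (s i))) (snd (s i)))))
        \<in> borel_measurable (\<Pi>\<^sub>M i\<in>{..<N}. P))"

(* A data-dependent minimizer need not be a measurable selection, so Q need not define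
   an event.  If it does, this says that the event has probability at least p. *)
definition holds_with_prob_at_least :: "'w measure \<Rightarrow> real \<Rightarrow> ('w \<Rightarrow> bool) \<Rightarrow> bool" where
  "holds_with_prob_at_least M p Q \<longleftrightarrow>
     (\<exists>A\<in>sets M. measure M A \<ge> p \<and> (\<forall>\<omega>\<in>A. Q \<omega>))"

end

theory Submission imports Defs
begin

text \<open>
  For a sign pattern \<open>e\<close>, exchanging the points \<open>i\<close> with \<open>e i = -1\<close> between the sample and an
  independent ghost sample bounds all deviations \<open>R g - Rhat g\<close> simultaneously by a sum of two
  suprema of signed empirical means of mixed samples, averaged over the ghost sample. Unlike the
  supremum of the deviations, this majorant is measurable under the given hypotheses. Its mean is
  the sum of the expected suprema for \<open>e\<close> and \<open>- e\<close>, hence at most twice the Rademacher complexity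
  of the losses for a suitable \<open>e\<close>. The majorant plus the infimum of \<open>Rhat\<close> dominates
  \<open>R ghat\<close> and changes by at most \<open>2 b / N\<close> with a single observation, so one application of
  McDiarmid's inequality gives the deviation term.

  The regularised solution is the projection of \<open>- y / \<gamma>\<close> onto \<open>Z\<close>, so the loss is
  \<open>r / \<gamma>\<close>-Lipschitz in the prediction, and Maurer's vector contraction argument passes from
  the losses to the predictors. As a single one-sided McDiarmid bound saves a factor 2 in the
  complexity term, a Khintchine inequality with constant \<open>1 / 2\<close> is enough there; it follows from the
  second and fourth moments.
\<close>

section \<open>Sign vectors and a Khintchine inequality\<close>

lemma finite_sign_vectors: "finite (sign_vectors :: (real^'d) set)"
proof -
  have "sign_vectors \<subseteq> vec_lambda ` (PiE (UNIV :: 'd set) (\<lambda>_. {-1, 1 :: real}))"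
  proof
    fix v :: "real^'d" assume "v \<in> sign_vectors"
    then have "vec_nth v \<in> PiE UNIV (\<lambda>_. {-1, 1})"
      by (auto simp: sign_vectors_def)
    then show "v \<in> vec_lambda ` (PiE (UNIV :: 'd set) (\<lambda>_. {-1, 1 :: real}))"
      by (metis imageI vec_nth_inverse)
  qed
  then show ?thesis
    by (rule finite_subset) (intro finite_imageI finite_PiE; simp)
qed

lemma sign_vectors_nonempty: "(sign_vectors :: (real^'d) set) \<noteq> {}"
proof -
  have "(\<chi> j. 1) \<in> (sign_vectors :: (real^'d) set)"
    by (simp add: sign_vectors_def)
  then show ?thesis by blast
qed

lemma card_sign_vectors_pos: "card (sign_vectors :: (real^'d) set) > 0"
  using finite_sign_vectors sign_vectors_nonempty by (simp add: card_gt_0_iff)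

lemma uminus_sign_vectors: "- v \<in> sign_vectors \<longleftrightarrow> v \<in> (sign_vectors :: (real^'d) set)"
  by (auto simp: sign_vectors_def minus_equation_iff[of "v $ _"])

lemma sign_vectors_square:
  "v \<in> (sign_vectors :: (real^'d) set) \<Longrightarrow> (v $ j)\<^sup>2 = 1"
  by (auto simp: sign_vectors_def power2_eq_1_iff)

lemma sum_sign_vectors_uminus:
  fixes f :: "real^'d \<Rightarrow> real"
  shows "(\<Sum>\<sigma>\<in>sign_vectors. f (- \<sigma>)) = (\<Sum>\<sigma>\<in>sign_vectors. f \<sigma>)"
  by (rule sum.reindex_bij_witness[of _ uminus uminus]) (auto simp: uminus_sign_vectors)

definition flip :: "'d \<Rightarrow> real^'d \<Rightarrow> real^'d" where
  "flip j v = (\<chi> i. if i = j then - v $ i else v $ i)"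

lemma flip_flip: "flip j (flip j v) = v"
  by (simp add: flip_def vec_eq_iff)

lemma flip_sign_vectors: "v \<in> sign_vectors \<Longrightarrow> flip j v \<in> sign_vectors"
  by (auto simp: flip_def sign_vectors_def minus_equation_iff[of "v $ _"])

text \<open>Flipping coordinate \<open>j\<close> permutes the sign vectors, fixes the factor
  \<open>f\<close> and negates \<open>\<sigma> $ j\<close>, so the sum equals its own
  negative.\<close>

lemma sum_sign_vectors_odd:
  fixes f :: "real^'d \<Rightarrow> real"
  assumes "\<And>\<sigma>. f (flip j \<sigma>) = f \<sigma>"
  shows "(\<Sum>\<sigma>\<in>sign_vectors. f \<sigma> * \<sigma> $ j) = 0"
proof -
  have "(\<Sum>\<sigma>\<in>sign_vectors. f \<sigma> * \<sigma> $ j) = (\<Sum>\<sigma>\<in>sign_vectors. f (flip j \<sigma>) * flip j \<sigma> $ j)"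
    by (rule sum.reindex_bij_witness[of _ "flip j" "flip j"])
       (auto simp: flip_flip flip_sign_vectors)
  also have "\<dots> = - (\<Sum>\<sigma>\<in>sign_vectors. f \<sigma> * \<sigma> $ j)"
    by (simp only: assms) (simp add: flip_def sum_negf)
  finally show ?thesis by simp
qed

text \<open>Induction on \<open>J\<close>, for both moments at once because the step for the fourth
  uses the second. When the power is expanded around the new coordinate, the terms of odd degree in
  it sum to 0 and its square is 1. The constant 3 is the fourth moment of a standard
  Gaussian.\<close>

lemma sign_moments:
  fixes v :: "real^'d"
  assumes "finite J"
  defines "q \<equiv> real (card (sign_vectors :: (real^'d) set))"
  shows "(\<Sum>\<sigma>\<in>sign_vectors. (\<Sum>j\<in>J. \<sigma> $ j * v $ j)\<^sup>2) = q * (\<Sum>j\<in>J. (v $ j)\<^sup>2)" (is "?A J")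
    and "(\<Sum>\<sigma>\<in>sign_vectors. (\<Sum>j\<in>J. \<sigma> $ j * v $ j) ^ 4) \<le> 3 * q * (\<Sum>j\<in>J. (v $ j)\<^sup>2)\<^sup>2" (is "?B J")
proof -
  have "?A J \<and> ?B J"
    using assms(1)
  proof (induction J)
    case empty
    then show ?case by simp
  next
    case (insert k J)
    let ?S = "sign_vectors :: (real^'d) set"
    let ?X = "\<lambda>\<sigma> :: real^'d. \<Sum>j\<in>J. \<sigma> $ j * v $ j"
    define c where "c = v $ k"
    define s where "s = (\<Sum>j\<in>J. (v $ j)\<^sup>2)"
    have s: "s \<ge> 0" unfolding s_def by (simp add: sum_nonneg)
    have X: "?X (flip k \<sigma>) = ?X \<sigma>" for \<sigma>
      by (rule sum.cong) (use insert.hyps in \<open>auto simp: flip_def\<close>)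
    have odd: "(\<Sum>\<sigma>\<in>?S. (b * ?X \<sigma> ^ m) * \<sigma> $ k) = 0" for m b
      by (rule sum_sign_vectors_odd) (simp only: X)
    have e2: "(\<Sum>\<sigma>\<in>?S. (\<sigma> $ k * c + ?X \<sigma>)\<^sup>2) = (\<Sum>\<sigma>\<in>?S. (?X \<sigma>)\<^sup>2) + q * c\<^sup>2"
    proof -
      have "(\<Sum>\<sigma>\<in>?S. (\<sigma> $ k * c + ?X \<sigma>)\<^sup>2)
          = (\<Sum>\<sigma>\<in>?S. (?X \<sigma>)\<^sup>2 + (2 * c * ?X \<sigma> ^ 1) * \<sigma> $ k + c\<^sup>2)"
      proof (rule sum.cong)
        fix \<sigma> :: "real^'d" assume "\<sigma> \<in> ?S"
        then have "(\<sigma> $ k)\<^sup>2 = 1" by (rule sign_vectors_square)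
        then show "(\<sigma> $ k * c + ?X \<sigma>)\<^sup>2 = (?X \<sigma>)\<^sup>2 + (2 * c * ?X \<sigma> ^ 1) * \<sigma> $ k + c\<^sup>2"
          by algebra
      qed simp
      also have "\<dots> = (\<Sum>\<sigma>\<in>?S. (?X \<sigma>)\<^sup>2) + q * c\<^sup>2"
        by (simp only: sum.distrib odd) (simp add: q_def)
      finally show ?thesis .
    qed
    have e4: "(\<Sum>\<sigma>\<in>?S. (\<sigma> $ k * c + ?X \<sigma>) ^ 4)
      = (\<Sum>\<sigma>\<in>?S. ?X \<sigma> ^ 4) + 6 * c\<^sup>2 * (\<Sum>\<sigma>\<in>?S. (?X \<sigma>)\<^sup>2) + q * c ^ 4"
    proof -
      have "(\<Sum>\<sigma>\<in>?S. (\<sigma> $ k * c + ?X \<sigma>) ^ 4)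
          = (\<Sum>\<sigma>\<in>?S. ?X \<sigma> ^ 4 + (4 * c * ?X \<sigma> ^ 3) * \<sigma> $ k + 6 * c\<^sup>2 * (?X \<sigma>)\<^sup>2
               + (4 * c ^ 3 * ?X \<sigma> ^ 1) * \<sigma> $ k + c ^ 4)"
      proof (rule sum.cong)
        fix \<sigma> :: "real^'d" assume "\<sigma> \<in> ?S"
        then have "(\<sigma> $ k)\<^sup>2 = 1" by (rule sign_vectors_square)
        then show "(\<sigma> $ k * c + ?X \<sigma>) ^ 4 = ?X \<sigma> ^ 4 + (4 * c * ?X \<sigma> ^ 3) * \<sigma> $ k
            + 6 * c\<^sup>2 * (?X \<sigma>)\<^sup>2 + (4 * c ^ 3 * ?X \<sigma> ^ 1) * \<sigma> $ k + c ^ 4"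
          by algebra
      qed simp
      also have "\<dots> = (\<Sum>\<sigma>\<in>?S. ?X \<sigma> ^ 4) + 6 * c\<^sup>2 * (\<Sum>\<sigma>\<in>?S. (?X \<sigma>)\<^sup>2) + q * c ^ 4"
        by (simp only: sum.distrib odd) (simp add: q_def sum_distrib_left)
      finally show ?thesis .
    qed
    have A: "(\<Sum>\<sigma>\<in>?S. (?X \<sigma>)\<^sup>2) = q * s" and B: "(\<Sum>\<sigma>\<in>?S. ?X \<sigma> ^ 4) \<le> 3 * q * s\<^sup>2"
      using insert.IH by (auto simp: s_def)
    have q: "q \<ge> 0" by (simp add: q_def)
    have "3 * q * s\<^sup>2 + 6 * c\<^sup>2 * (q * s) + q * c ^ 4 \<le> 3 * q * (c\<^sup>2 + s)\<^sup>2"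
    proof -
      have "3 * q * (c\<^sup>2 + s)\<^sup>2 - (3 * q * s\<^sup>2 + 6 * c\<^sup>2 * (q * s) + q * c ^ 4) = 2 * (q * c ^ 4)"
        by algebra
      moreover have "q * c ^ 4 \<ge> 0" using q by simp
      ultimately show ?thesis by linarith
    qed
    then show ?case
      using insert.hyps A B e2 e4 by (simp add: c_def[symmetric] s_def[symmetric] algebra_simps)
  qed
  then show "?A J" "?B J" by auto
qed

text \<open>Any constant of at least \<open>1 / (2 * sqrt 2)\<close> in place of \<open>1 / 2\<close> would do for the
  final bound, which is why the sharp Khintchine constant is not needed.\<close>

lemma khintchine_sign_vectors:
  fixes v :: "real^'d"
  shows "real (card (sign_vectors :: (real^'d) set)) * norm v \<le> 2 * (\<Sum>\<sigma>\<in>sign_vectors. \<bar>\<sigma> \<bullet> v\<bar>)"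
proof (cases "v = 0")
  case False
  define n where "n = norm v"
  define q where "q = real (card (sign_vectors :: (real^'d) set))"
  have n: "n > 0" using False by (simp add: n_def)
  have inner: "\<sigma> \<bullet> v = (\<Sum>j\<in>UNIV. \<sigma> $ j * v $ j)" for \<sigma>
    by (simp add: inner_vec_def)
  have n2: "n\<^sup>2 = (\<Sum>j\<in>UNIV. (v $ j)\<^sup>2)"
    unfolding n_def power2_norm_eq_inner inner by (simp add: power2_eq_square)
  have m2: "(\<Sum>\<sigma>\<in>sign_vectors. (\<sigma> \<bullet> v)\<^sup>2) = q * n\<^sup>2"
    and m4: "(\<Sum>\<sigma>\<in>sign_vectors. (\<sigma> \<bullet> v) ^ 4) \<le> 3 * q * (n\<^sup>2)\<^sup>2"
    using sign_moments[of "UNIV :: 'd set" v] by (auto simp: inner n2 q_def)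
  \<comment> \<open>For \<open>t = \<bar>\<sigma> \<bullet> v\<bar> / n\<close> the second moment is
    1 and the fourth is at most 3, so the average of the left-hand side is at least
    \<open>3/4 - 3/12 = 1/2\<close>. This is the source of the constant.\<close>
  have elem: "3 / 4 * t\<^sup>2 - t ^ 4 / 12 \<le> t" if "t \<ge> 0" for t :: real
  proof -
    \<comment> \<open>It remains to see that \<open>t ^ 3 - 9 * t + 12\<close> is nonnegative. Its
      minimum on the positive axis is at \<open>sqrt 3\<close>, for which \<open>7/4\<close> is a
      nearby rational; the product expresses that \<open>t ^ 3\<close> lies above its tangent at
      \<open>7/4\<close>.\<close>
    have "(t - 7/4)\<^sup>2 * (t + 7/2) \<ge> 0" using that by simp
    moreover have "(t - 7/4)\<^sup>2 * (t + 7/2) = t ^ 3 - 147/16 * t + 343/32"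
      by algebra
    ultimately have "t ^ 3 - 9 * t + 12 \<ge> 0" using that by linarith
    then have "t * (t ^ 3 - 9 * t + 12) \<ge> 0" using that by simp
    also have "t * (t ^ 3 - 9 * t + 12) = 12 * (t - (3 / 4 * t\<^sup>2 - t ^ 4 / 12))"
      by (simp add: power2_eq_square power3_eq_cube power4_eq_xxxx algebra_simps)
    finally show ?thesis by (simp only: zero_le_mult_iff) simp
  qed
  have "q / 2 = 3 / 4 * (q * n\<^sup>2 / n\<^sup>2) - 3 * q * (n\<^sup>2)\<^sup>2 / n ^ 4 / 12"
    using n by (simp add: field_simps)
  also have "\<dots> \<le> 3 / 4 * ((\<Sum>\<sigma>\<in>sign_vectors. (\<sigma> \<bullet> v)\<^sup>2) / n\<^sup>2)
                  - (\<Sum>\<sigma>\<in>sign_vectors. (\<sigma> \<bullet> v) ^ 4) / n ^ 4 / 12"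
    unfolding m2 using m4 n by (intro diff_mono divide_right_mono order_refl) auto
  also have "\<dots> = (\<Sum>\<sigma>\<in>sign_vectors. 3 / 4 * (\<bar>\<sigma> \<bullet> v\<bar> / n)\<^sup>2 - (\<bar>\<sigma> \<bullet> v\<bar> / n) ^ 4 / 12)"
    by (simp add: sum_subtractf sum_divide_distrib sum_distrib_left power_divide)
  also have "\<dots> \<le> (\<Sum>\<sigma>\<in>sign_vectors. \<bar>\<sigma> \<bullet> v\<bar> / n)"
    using n by (intro sum_mono elem) auto
  also have "\<dots> = (\<Sum>\<sigma>\<in>sign_vectors. \<bar>\<sigma> \<bullet> v\<bar>) / n"
    by (simp add: sum_divide_distrib)
  finally show ?thesis
    using n by (simp add: field_simps n_def[symmetric] q_def[symmetric])
qed simp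

section \<open>Vector contraction\<close>

lemma sum_PiE_insert:
  assumes "i \<notin> I"
  shows "(\<Sum>e\<in>PiE (insert i I) (\<lambda>_. B). f e) = (\<Sum>y\<in>B. \<Sum>e\<in>PiE I (\<lambda>_. B). f (e(i := y)))"
proof -
  have "(\<Sum>e\<in>PiE (insert i I) (\<lambda>_. B). f e)
      = (\<Sum>(y, e)\<in>B \<times> PiE I (\<lambda>_. B). f (e(i := y)))"
    unfolding PiE_insert_eq using inj_combinator[OF assms, of "\<lambda>_. B"]
    by (subst sum.reindex) (auto simp: case_prod_beta)
  then show ?thesis by (simp add: sum.cartesian_product)
qed

text \<open>Let \<open>g1\<close> and \<open>g2\<close> attain the maxima for the signs 1 and -1.
  The Lipschitz condition bounds \<open>h g1 - h g2\<close> by a norm, and Khintchine turns the norm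
  into an average of \<open>\<bar>\<sigma> \<bullet> (v g1 - v g2)\<bar>\<close>. Finiteness of
  \<open>T\<close> makes the maxima attained.\<close>

lemma vector_contraction_step:
  fixes v :: "'g \<Rightarrow> real^'d" and A h :: "'g \<Rightarrow> real"
  assumes T: "finite T" "T \<noteq> {}"
    and lip: "\<And>g g'. g \<in> T \<Longrightarrow> g' \<in> T \<Longrightarrow> \<bar>h g - h g'\<bar> \<le> L * norm (v g - v g')"
    and L: "L \<ge> 0"
  shows "(\<Sum>e\<in>{-1, 1}. Max ((\<lambda>g. A g + e * h g) ` T)) / 2
     \<le> (\<Sum>\<sigma>\<in>sign_vectors. Max ((\<lambda>g. A g + 2 * L * (\<sigma> \<bullet> v g)) ` T))
           / card (sign_vectors :: (real^'d) set)"
proof -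
  define q where "q = real (card (sign_vectors :: (real^'d) set))"
  have q: "q > 0" using card_sign_vectors_pos[where 'd='d] by (simp add: q_def)
  define m where "m \<sigma> = Max ((\<lambda>g. A g + 2 * L * (\<sigma> \<bullet> v g)) ` T)" for \<sigma>
  have m: "A g + 2 * L * (\<sigma> \<bullet> v g) \<le> m \<sigma>" if "g \<in> T" for g \<sigma>
    unfolding m_def using T that by (intro Max_ge) auto
  have ex: "\<exists>g\<in>T. Max (f ` T) = f g" for f :: "'g \<Rightarrow> real"
    using Max_in[of "f ` T"] T by (auto simp: image_iff)
  obtain g1 where g1: "g1 \<in> T" "Max ((\<lambda>g. A g + 1 * h g) ` T) = A g1 + h g1"
    using ex[of "\<lambda>g. A g + 1 * h g"] by auto
  obtain g2 where g2: "g2 \<in> T" "Max ((\<lambda>g. A g + (-1) * h g) ` T) = A g2 - h g2"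
    using ex[of "\<lambda>g. A g + (-1) * h g"] by auto
  have "q * (A g1 + h g1 + (A g2 - h g2)) \<le> q * (A g1 + A g2 + L * norm (v g1 - v g2))"
    using lip[OF g1(1) g2(1)] q by (intro mult_left_mono) auto
  also have "\<dots> = q * (A g1 + A g2) + L * (q * norm (v g1 - v g2))"
    by (simp add: algebra_simps)
  also have "\<dots> \<le> q * (A g1 + A g2) + L * (2 * (\<Sum>\<sigma>\<in>sign_vectors. \<bar>\<sigma> \<bullet> (v g1 - v g2)\<bar>))"
    using khintchine_sign_vectors[of "v g1 - v g2"] L
    by (intro add_left_mono mult_left_mono) (auto simp: q_def)
  also have "\<dots> = (\<Sum>\<sigma>\<in>sign_vectors. A g1 + A g2 + 2 * L * \<bar>\<sigma> \<bullet> (v g1 - v g2)\<bar>)"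
    by (simp add: sum.distrib q_def sum_distrib_left algebra_simps)
  \<comment> \<open>The absolute value is resolved by testing \<open>g1\<close> against whichever of
    \<open>\<sigma>\<close> and \<open>- \<sigma>\<close> has nonnegative inner product with
    \<open>v g1 - v g2\<close>, and \<open>g2\<close> against the other one.\<close>
  also have "\<dots> \<le> (\<Sum>\<sigma>\<in>sign_vectors. m \<sigma> + m (- \<sigma>))"
  proof (rule sum_mono)
    fix \<sigma> :: "real^'d"
    show "A g1 + A g2 + 2 * L * \<bar>\<sigma> \<bullet> (v g1 - v g2)\<bar> \<le> m \<sigma> + m (- \<sigma>)"
    proof (cases "\<sigma> \<bullet> (v g1 - v g2) \<ge> 0")
      case True
      then show ?thesis using m[OF g1(1), of \<sigma>] m[OF g2(1), of "- \<sigma>"]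
        by (simp add: inner_diff_right algebra_simps)
    next
      case False
      then show ?thesis using m[OF g1(1), of "- \<sigma>"] m[OF g2(1), of \<sigma>]
        by (simp add: inner_diff_right algebra_simps)
    qed
  qed
  also have "\<dots> = 2 * (\<Sum>\<sigma>\<in>sign_vectors. m \<sigma>)"
    by (simp add: sum.distrib sum_sign_vectors_uminus)
  finally have "(A g1 + h g1 + (A g2 - h g2)) / 2 \<le> (\<Sum>\<sigma>\<in>sign_vectors. m \<sigma>) / q"
    using q by (simp add: field_simps)
  moreover have "(\<Sum>e\<in>{-1, 1}. Max ((\<lambda>g. A g + e * h g) ` T)) = A g1 + h g1 + (A g2 - h g2)"
    using g1(2) g2(2) by simp
  ultimately show ?thesis by (simp add: m_def q_def)
qed

text \<open>The scalar signs are exchanged for vector signs one index at a time. The offset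
  \<open>A\<close> is arbitrary in the induction, so that it can absorb the terms of all indices not
  being treated.\<close>

lemma vector_contraction_Max:
  fixes v :: "'i \<Rightarrow> 'g \<Rightarrow> real^'d" and A :: "'g \<Rightarrow> real" and h :: "'i \<Rightarrow> 'g \<Rightarrow> real"
  assumes I: "finite I" and T: "finite T" "T \<noteq> {}"
    and lip: "\<And>i g g'. i \<in> I \<Longrightarrow> g \<in> T \<Longrightarrow> g' \<in> T \<Longrightarrow> \<bar>h i g - h i g'\<bar> \<le> L * norm (v i g - v i g')"
    and L: "L \<ge> 0"
  shows "(\<Sum>e\<in>PiE I (\<lambda>_. {-1, 1}). Max ((\<lambda>g. A g + (\<Sum>i\<in>I. e i * h i g)) ` T)) / 2 ^ card I
     \<le> (\<Sum>\<sigma>\<in>PiE I (\<lambda>_. sign_vectors). Max ((\<lambda>g. A g + (\<Sum>i\<in>I. 2 * L * (\<sigma> i \<bullet> v i g))) ` T))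
           / card (sign_vectors :: (real^'d) set) ^ card I"
  using I lip
proof (induction I arbitrary: A)
  case empty
  then show ?case by simp
next
  case (insert k I)
  let ?S = "sign_vectors :: (real^'d) set"
  define q where "q = real (card ?S)"
  have q: "q > 0" using card_sign_vectors_pos[where 'd='d] by (simp add: q_def)
  have upd: "(\<Sum>i\<in>I. (e(k := y)) i * h i g) = (\<Sum>i\<in>I. e i * h i g)" for e y g
    using insert.hyps by (intro sum.cong) auto
  have upd': "(\<Sum>i\<in>I. L * (2 * ((\<sigma>(k := y)) i \<bullet> v i g))) = (\<Sum>i\<in>I. L * (2 * (\<sigma> i \<bullet> v i g)))" for \<sigma> y g
    using insert.hyps by (intro sum.cong) auto
  \<comment> \<open>\<open>B e\<close> is the offset for the one-index step, with the scalar signs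
    on \<open>I\<close> frozen; \<open>C \<tau>\<close> is the offset for the induction hypothesis,
    with the vector sign of \<open>k\<close> frozen.\<close>
  define B where "B e g = A g + (\<Sum>i\<in>I. e i * h i g)" for e g
  define C where "C \<tau> g = A g + 2 * L * (\<tau> \<bullet> v k g)" for \<tau> g
  have "(\<Sum>e\<in>PiE (insert k I) (\<lambda>_. {-1, 1}). Max ((\<lambda>g. A g + (\<Sum>i\<in>insert k I. e i * h i g)) ` T))
          / 2 ^ card (insert k I)
      = (\<Sum>e\<in>PiE I (\<lambda>_. {-1, 1}). (\<Sum>y\<in>{-1, 1}. Max ((\<lambda>g. B e g + y * h k g) ` T)) / 2) / 2 ^ card I"
    using insert.hyps
    by (subst sum_PiE_insert[OF insert.hyps(2)], subst sum.swap)
       (simp add: upd B_def sum_divide_distrib add_divide_distrib add_ac sum.distrib del: fun_upd_apply add: fun_upd_same)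
  also have "\<dots> \<le> (\<Sum>e\<in>PiE I (\<lambda>_. {-1, 1}).
      (\<Sum>\<tau>\<in>?S. Max ((\<lambda>g. B e g + 2 * L * (\<tau> \<bullet> v k g)) ` T)) / q) / 2 ^ card I"
    unfolding q_def using insert.prems
    by (intro divide_right_mono sum_mono vector_contraction_step T L) auto
  also have "\<dots> = (\<Sum>\<tau>\<in>?S. (\<Sum>e\<in>PiE I (\<lambda>_. {-1, 1}).
      Max ((\<lambda>g. C \<tau> g + (\<Sum>i\<in>I. e i * h i g)) ` T)) / 2 ^ card I) / q"
    by (simp add: B_def C_def sum_divide_distrib add_ac field_simps, subst sum.swap) simp
  also have "\<dots> \<le> (\<Sum>\<tau>\<in>?S. (\<Sum>\<sigma>\<in>PiE I (\<lambda>_. ?S).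
      Max ((\<lambda>g. C \<tau> g + (\<Sum>i\<in>I. 2 * L * (\<sigma> i \<bullet> v i g))) ` T)) / q ^ card I) / q"
    unfolding q_def using insert.prems q
    by (intro divide_right_mono sum_mono order_trans[OF insert.IH]) auto
  also have "\<dots> = (\<Sum>\<sigma>\<in>PiE (insert k I) (\<lambda>_. ?S).
      Max ((\<lambda>g. A g + (\<Sum>i\<in>insert k I. 2 * L * (\<sigma> i \<bullet> v i g))) ` T)) / q ^ card (insert k I)"
    using insert.hyps q
    by (subst sum_PiE_insert[OF insert.hyps(2)])
       (simp add: upd' C_def sum_divide_distrib add_ac field_simps del: fun_upd_apply add: fun_upd_same)
  finally show ?case by (simp add: q_def)
qed

section \<open>Integration over independent uniform signs\<close>

text \<open>Fubini one coordinate at a time. The integrand is extended nonnegative because it will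
  be the positive or negative part of a Rademacher supremum, which may be infinite.\<close>

lemma nn_integral_PiM_uniform_count_measure:
  assumes I: "finite I" and B: "finite B" "B \<noteq> {}"
    and f: "f \<in> borel_measurable (PiM I (\<lambda>_. uniform_count_measure B))"
  shows "(\<integral>\<^sup>+\<sigma>. f \<sigma> \<partial>PiM I (\<lambda>_. uniform_count_measure B))
     = (\<Sum>\<sigma>\<in>PiE I (\<lambda>_. B). f \<sigma>) * ennreal (1 / card B) ^ card I"
proof -
  interpret prob_space "uniform_count_measure B"
    using B by (rule prob_space_uniform_count_measure)
  interpret product_sigma_finite "\<lambda>_. uniform_count_measure B"
    by standard
  show ?thesis
    using I f
  proof (induction I arbitrary: f)
    case empty
    then show ?case by (simp add: nn_integral_empty)
  next
    case (insert k I)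
    note insert.prems[measurable]
    have "(\<integral>\<^sup>+\<sigma>. f \<sigma> \<partial>PiM (insert k I) (\<lambda>_. uniform_count_measure B))
       = (\<integral>\<^sup>+ y. (\<integral>\<^sup>+ x. f (x(k := y)) \<partial>(PiM I (\<lambda>_. uniform_count_measure B))) \<partial>uniform_count_measure B)"
      by (rule product_nn_integral_insert_rev[OF insert.hyps insert.prems])
    also have "\<dots> = (\<integral>\<^sup>+ y. (\<Sum>\<sigma>\<in>PiE I (\<lambda>_. B). f (\<sigma>(k := y))) * ennreal (1 / card B) ^ card I
          \<partial>uniform_count_measure B)"
    proof (rule nn_integral_cong)
      fix y assume y: "y \<in> space (uniform_count_measure B)"
      show "(\<integral>\<^sup>+ x. f (x(k := y)) \<partial>(PiM I (\<lambda>_. uniform_count_measure B)))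
        = (\<Sum>\<sigma>\<in>PiE I (\<lambda>_. B). f (\<sigma>(k := y))) * ennreal (1 / card B) ^ card I"
        using y by (intro insert.IH) measurable
    qed
    also have "\<dots> = (\<Sum>y\<in>B. (\<Sum>\<sigma>\<in>PiE I (\<lambda>_. B). f (\<sigma>(k := y))) * ennreal (1 / card B) ^ card I
          * ennreal (1 / card B))"
      unfolding uniform_count_measure_def using B
      by (subst nn_integral_point_measure_finite) (auto simp: mult_ac)
    also have "\<dots> = (\<Sum>\<sigma>\<in>PiE (insert k I) (\<lambda>_. B). f \<sigma>) * ennreal (1 / card B) ^ card (insert k I)"
      using insert.hyps
      by (subst sum_PiE_insert[OF insert.hyps(2)]) (simp add: mult_ac flip: sum_distrib_left)
    finally show ?case .
  qed
qed

section \<open>Bounded differences\<close>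

text \<open>Instead of a martingale, one coordinate is integrated out at a time: the partial mean
  \<open>h\<close> inherits the bounds \<open>K\<close> and \<open>c\<close>, and Hoeffding's lemma
  for the removed coordinate contributes a factor
  \<open>exp (l\<^sup>2 * c\<^sup>2 / 8)\<close>.\<close>

lemma mcdiarmid_nn_integral:
  fixes f :: "('i \<Rightarrow> 'a) \<Rightarrow> real" and c l K :: real
  assumes P: "prob_space P" and I: "finite I"
    and f: "f \<in> borel_measurable (PiM I (\<lambda>_. P))"
    and bnd: "\<And>s. s \<in> space (PiM I (\<lambda>_. P)) \<Longrightarrow> \<bar>f s\<bar> \<le> K"
    and diff: "\<And>s i y. s \<in> space (PiM I (\<lambda>_. P)) \<Longrightarrow> i \<in> I \<Longrightarrow> y \<in> space P \<Longrightarrow>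
      \<bar>f (s(i := y)) - f s\<bar> \<le> c"
    and l: "l > 0"
  shows "(\<integral>\<^sup>+s. exp (l * (f s - (\<integral>t. f t \<partial>PiM I (\<lambda>_. P)))) \<partial>PiM I (\<lambda>_. P))
     \<le> ennreal (exp (l\<^sup>2 * (card I * c\<^sup>2) / 8))"
proof -
  interpret prob_space P by fact
  interpret product_sigma_finite "\<lambda>_. P"
    by standard
  show ?thesis
    using I f bnd diff
  proof (induction I arbitrary: f)
    case empty
    have "(\<integral>t. f t \<partial>PiM {} (\<lambda>_. P)) = f (\<lambda>_. undefined)"
      by (simp add: PiM_empty lebesgue_integral_count_space_finite)
    then show ?case
      by (subst nn_integral_empty) auto
  next
    case (insert k I)
    let ?I = "PiM I (\<lambda>_. P)" and ?kI = "PiM (insert k I) (\<lambda>_. P)"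
    interpret I: prob_space ?I by (intro prob_space_PiM P)
    interpret kI: prob_space ?kI by (intro prob_space_PiM P)
    note insert.prems(1)[measurable]
    have upd: "x(k := y) \<in> space ?kI" if "x \<in> space ?I" "y \<in> space P" for x y
      using that insert.hyps by (auto simp: space_PiM PiE_iff extensional_def)
    define h where "h x = (\<integral>y. f (x(k := y)) \<partial>P)" for x
    define m where "m = (\<integral>t. f t \<partial>?kI)"
    have h_meas[measurable]: "h \<in> borel_measurable ?I"
      unfolding h_def by measurable
    have sec_meas[measurable]: "(\<lambda>y. f (x(k := y))) \<in> borel_measurable P" if "x \<in> space ?I" for x
      using that by measurable
    have sec_int: "integrable P (\<lambda>y. f (x(k := y)))" if x: "x \<in> space ?I" for x
      using sec_meas[OF x] insert.prems(2)[OF upd[OF x]]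
      by (intro integrable_const_bound[of _ K] AE_I2) (auto simp del: fun_upd_apply)
    have h_bnd: "\<bar>h x\<bar> \<le> K" if x: "x \<in> space ?I" for x
    proof -
      have "\<bar>h x\<bar> \<le> (\<integral>y. \<bar>f (x(k := y))\<bar> \<partial>P)"
        unfolding h_def by (rule integral_abs_bound)
      also have "\<dots> \<le> K"
        using insert.prems(2)[OF upd[OF x]] sec_int[OF x]
        by (intro integral_le_const AE_I2) (auto simp del: fun_upd_apply)
      finally show ?thesis .
    qed
    have h_diff: "\<bar>h (x(i := y)) - h x\<bar> \<le> c"
      if x: "x \<in> space ?I" and i: "i \<in> I" and y: "y \<in> space P" for x i y
    proof -
      have x': "x(i := y) \<in> space ?I"
        using x i y by (auto simp: space_PiM PiE_iff extensional_def)
      have ki: "x(i := y, k := z) = x(k := z, i := y)" for z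
        using i insert.hyps by (intro fun_upd_twist) auto
      have "h (x(i := y)) - h x = (\<integral>z. f (x(i := y, k := z)) - f (x(k := z)) \<partial>P)"
        unfolding h_def using sec_int[OF x] sec_int[OF x'] by simp
      also have "\<bar>\<dots>\<bar> \<le> (\<integral>z. \<bar>f (x(i := y, k := z)) - f (x(k := z))\<bar> \<partial>P)"
        by (rule integral_abs_bound)
      also have "\<dots> \<le> c"
        using insert.prems(3)[OF upd[OF x] _ y, of _ i] i sec_int[OF x] sec_int[OF x']
        by (intro integral_le_const AE_I2) (auto simp: ki simp del: fun_upd_apply)
      finally show ?thesis .
    qed
    have "integrable ?kI f"
      using insert.prems(1,2) by (intro kI.integrable_const_bound[of _ K] AE_I2) auto
    then have m_eq: "(\<integral>x. h x \<partial>?I) = m"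
      unfolding m_def h_def by (rule product_integral_insert[OF insert.hyps, symmetric])
    have sec: "(\<integral>\<^sup>+y. ennreal (exp (l * (f (x(k := y)) - h x))) \<partial>P) \<le> ennreal (exp (l\<^sup>2 * c\<^sup>2 / 8))"
      if x: "x \<in> space ?I" for x
    proof -
      \<comment> \<open>Any two values of this section differ by at most \<open>c\<close>, so
        starting from their infimum they fit into an interval of length \<open>c\<close>. This is
        sharper than an interval of length \<open>2 * c\<close> around one of the values.\<close>
      define a where "a = (INF y\<in>space P. f (x(k := y)))"
      have bdd: "bdd_below ((\<lambda>y. f (x(k := y))) ` space P)"
        using insert.prems(2)[OF upd[OF x]]
        by (intro bdd_belowI2[where m="- K"]) (metis abs_le_D2 minus_le_iff)
      have in_ivl: "f (x(k := y)) \<in> {a..a + c}" if y: "y \<in> space P" for y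
      proof -
        have "a \<le> f (x(k := y))"
          unfolding a_def using y bdd by (intro cINF_lower)
        moreover have "f (x(k := y)) - c \<le> a"
          unfolding a_def
        proof (rule cINF_greatest)
          show "space P \<noteq> {}" using y by auto
          fix z assume z: "z \<in> space P"
          show "f (x(k := y)) - c \<le> f (x(k := z))"
            using insert.prems(3)[OF upd[OF x z] insertI1 y]
            by (simp add: abs_le_iff del: fun_upd_apply)
        qed
        ultimately show ?thesis by auto
      qed
      interpret interval_bounded_random_variable P "\<lambda>y. f (x(k := y))" a "a + c"
        using sec_meas[OF x] in_ivl by unfold_locales (auto intro!: AE_I2 simp del: fun_upd_apply)
      show ?thesis
        using Hoeffdings_lemma_nn_integral[OF l] by (simp add: h_def)
    qed
    have "(\<integral>\<^sup>+s. exp (l * (f s - m)) \<partial>?kI)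
        = (\<integral>\<^sup>+x. (\<integral>\<^sup>+y. exp (l * (f (x(k := y)) - m)) \<partial>P) \<partial>?I)"
      by (rule product_nn_integral_insert[OF insert.hyps]) measurable
    \<comment> \<open>The exponent splits as \<open>(f - h) + (h - m)\<close>. The second part does
      not involve the coordinate \<open>k\<close> and is left to the induction hypothesis.\<close>
    also have "\<dots> = (\<integral>\<^sup>+x. exp (l * (h x - m)) * (\<integral>\<^sup>+y. exp (l * (f (x(k := y)) - h x)) \<partial>P) \<partial>?I)"
      by (intro nn_integral_cong, subst nn_integral_cmult[symmetric])
         (auto simp flip: ennreal_mult exp_add simp: algebra_simps)
    also have "\<dots> \<le> (\<integral>\<^sup>+x. exp (l * (h x - m)) * ennreal (exp (l\<^sup>2 * c\<^sup>2 / 8)) \<partial>?I)"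
      by (intro nn_integral_mono mult_left_mono sec) auto
    also have "\<dots> = (\<integral>\<^sup>+x. exp (l * (h x - m)) \<partial>?I) * ennreal (exp (l\<^sup>2 * c\<^sup>2 / 8))"
      by (rule nn_integral_multc) auto
    also have "\<dots> \<le> ennreal (exp (l\<^sup>2 * (card I * c\<^sup>2) / 8)) * ennreal (exp (l\<^sup>2 * c\<^sup>2 / 8))"
      by (intro mult_right_mono insert.IH[OF h_meas h_bnd h_diff, unfolded m_eq]) auto
    also have "\<dots> = ennreal (exp (l\<^sup>2 * (card (insert k I) * c\<^sup>2) / 8))"
      using insert.hyps by (simp flip: ennreal_mult exp_add add: field_simps)
    finally show ?case by (simp add: m_def)
  qed
qed

theorem mcdiarmid:
  fixes f :: "('i \<Rightarrow> 'a) \<Rightarrow> real" and c t K :: real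
  assumes P: "prob_space P" and I: "finite I" "I \<noteq> {}"
    and f[measurable]: "f \<in> borel_measurable (PiM I (\<lambda>_. P))"
    and bnd: "\<And>s. s \<in> space (PiM I (\<lambda>_. P)) \<Longrightarrow> \<bar>f s\<bar> \<le> K"
    and diff: "\<And>s i y. s \<in> space (PiM I (\<lambda>_. P)) \<Longrightarrow> i \<in> I \<Longrightarrow> y \<in> space P \<Longrightarrow>
      \<bar>f (s(i := y)) - f s\<bar> \<le> c"
    and c: "c > 0" and t: "t > 0"
  shows "measure (PiM I (\<lambda>_. P))
     {s \<in> space (PiM I (\<lambda>_. P)). f s - (\<integral>t. f t \<partial>PiM I (\<lambda>_. P)) \<ge> t} \<le> exp (- 2 * t\<^sup>2 / (card I * c\<^sup>2))"
proof -
  let ?M = "PiM I (\<lambda>_. P)"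
  interpret prob_space ?M by (intro prob_space_PiM P)
  define D where "D = card I * c\<^sup>2"
  have D: "D > 0" using I c by (simp add: D_def card_gt_0_iff)
  \<comment> \<open>This \<open>l\<close> minimizes the Chernoff exponent
    \<open>- l * t + l\<^sup>2 * D / 8\<close>, with minimum
    \<open>- 2 * t\<^sup>2 / D\<close>.\<close>
  define l where "l = 4 * t / D"
  have l: "l > 0" using D t by (simp add: l_def)
  define m where "m = (\<integral>t. f t \<partial>?M)"
  have "emeasure ?M {s \<in> space ?M. f s - m \<ge> t} \<le> emeasure ?M {s \<in> space ?M. 1 \<le> ennreal (exp (- l * t)) * ennreal (exp (l * (f s - m)))}"
  proof (intro emeasure_mono subsetI)
    fix s assume "s \<in> {s \<in> space ?M. f s - m \<ge> t}"
    then have "s \<in> space ?M" "1 \<le> exp (- l * t + l * (f s - m))"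
      using l by auto
    then show "s \<in> {s \<in> space ?M. 1 \<le> ennreal (exp (- l * t)) * ennreal (exp (l * (f s - m)))}"
      by (simp flip: ennreal_mult exp_add)
  qed measurable
  also have "\<dots> \<le> ennreal (exp (- l * t)) * (\<integral>\<^sup>+s. exp (l * (f s - m)) \<partial>?M)"
    using nn_integral_Markov_inequality[of "\<lambda>s. ennreal (exp (l * (f s - m)))" "space ?M" ?M "ennreal (exp (- l * t))"]
    by (simp cong: nn_integral_cong)
  also have "\<dots> \<le> ennreal (exp (- l * t)) * ennreal (exp (l\<^sup>2 * D / 8))"
    unfolding m_def D_def by (intro mult_left_mono mcdiarmid_nn_integral[OF P I(1) f bnd diff l]) auto
  also have "\<dots> = ennreal (exp (- 2 * t\<^sup>2 / D))"
    using D by (simp flip: ennreal_mult exp_add add: l_def field_simps power2_eq_square)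
  finally show ?thesis
    by (simp add: emeasure_eq_measure m_def D_def)
qed

section \<open>Symmetrization\<close>

text \<open>In use \<open>s\<close> is the observed sample and \<open>t\<close> the ghost sample.
  The restriction to \<open>I\<close> keeps the result extensional, as points of the product space
  are.\<close>

definition mix :: "'i set \<Rightarrow> ('i \<Rightarrow> real) \<Rightarrow> ('i \<Rightarrow> 'a) \<Rightarrow> ('i \<Rightarrow> 'a) \<Rightarrow> 'i \<Rightarrow> 'a" where
  "mix I e t s = (\<lambda>i\<in>I. if e i = 1 then t i else s i)"

lemma measurable_mix:
  "(\<lambda>(t, s). mix I e t s) \<in> PiM I (\<lambda>_. P) \<Otimes>\<^sub>M PiM I (\<lambda>_. P) \<rightarrow>\<^sub>M PiM I (\<lambda>_. P)"
proof -
  have "(\<lambda>p. \<lambda>i\<in>I. if e i = 1 then fst p i else snd p i)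
      \<in> PiM I (\<lambda>_. P) \<Otimes>\<^sub>M PiM I (\<lambda>_. P) \<rightarrow>\<^sub>M PiM I (\<lambda>_. P)"
    by (intro measurable_restrict) auto
  then show ?thesis by (simp add: mix_def case_prod_beta)
qed

lemma mix_space:
  "t \<in> space (PiM I (\<lambda>_. P)) \<Longrightarrow> s \<in> space (PiM I (\<lambda>_. P)) \<Longrightarrow> mix I e t s \<in> space (PiM I (\<lambda>_. P))"
  by (auto simp: space_PiM mix_def PiE_iff)

text \<open>The preimage of a box is a product of two boxes: each factor of the given box constrains
  one of the two samples, and the other sample is unconstrained at that coordinate. Boxes determine
  the product measure.\<close>

lemma distr_mix:
  assumes P: "prob_space P" and I: "finite I"
  shows "distr (PiM I (\<lambda>_. P) \<Otimes>\<^sub>M PiM I (\<lambda>_. P)) (PiM I (\<lambda>_. P)) (\<lambda>(t, s). mix I e t s)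
     = PiM I (\<lambda>_. P)"
proof -
  interpret prob_space P by fact
  interpret product_sigma_finite "\<lambda>_. P" by standard
  interpret I: finite_product_sigma_finite "\<lambda>_. P" I by standard fact
  show ?thesis
  proof (rule PiM_eqI[OF I])
    fix A assume A: "\<And>i. i \<in> I \<Longrightarrow> A i \<in> sets P"
    define B where "B i = (if e i = 1 then A i else space P)" for i
    define C where "C i = (if e i = 1 then space P else A i)" for i
    have sub: "A i \<subseteq> space P" if "i \<in> I" for i using A[OF that] sets.sets_into_space by auto
    have B: "B i \<in> sets P" and C: "C i \<in> sets P" if "i \<in> I" for i
      using A[OF that] by (auto simp: B_def C_def)
    have key: "x \<in> space P \<and> y \<in> space P \<and> (if e i = 1 then x else y) \<in> A i \<longleftrightarrow> x \<in> B i \<and> y \<in> C i"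
      if "i \<in> I" for i x y
      using sub[OF that] by (auto simp: B_def C_def)
    have mem: "mix I e t s \<in> PiE I A \<longleftrightarrow> (\<forall>i\<in>I. (if e i = 1 then t i else s i) \<in> A i)" for t s
      by (simp add: mix_def PiE_iff)
    have "mix I e t s \<in> PiE I A \<and> t \<in> PiE I (\<lambda>_. space P) \<and> s \<in> PiE I (\<lambda>_. space P)
        \<longleftrightarrow> t \<in> PiE I B \<and> s \<in> PiE I C" for t s
    proof -
      have "(\<forall>i\<in>I. t i \<in> space P \<and> s i \<in> space P \<and> (if e i = 1 then t i else s i) \<in> A i)
          \<longleftrightarrow> (\<forall>i\<in>I. t i \<in> B i \<and> s i \<in> C i)"
        by (rule ball_cong[OF refl key])
      then show ?thesis unfolding mem unfolding PiE_iff ball_conj_distrib by argo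
    qed
    then have "(\<lambda>(t, s). mix I e t s) -` Pi\<^sub>E I A \<inter> space (PiM I (\<lambda>_. P) \<Otimes>\<^sub>M PiM I (\<lambda>_. P))
        = PiE I B \<times> PiE I C"
      by (simp add: set_eq_iff space_pair_measure space_PiM)
    then have "emeasure (distr (PiM I (\<lambda>_. P) \<Otimes>\<^sub>M PiM I (\<lambda>_. P)) (PiM I (\<lambda>_. P)) (\<lambda>(t, s). mix I e t s)) (PiE I A)
        = emeasure (PiM I (\<lambda>_. P)) (PiE I B) * emeasure (PiM I (\<lambda>_. P)) (PiE I C)"
      using A B C I
      by (subst emeasure_distr[OF measurable_mix])
         (auto intro!: sets_PiM_I_finite I.emeasure_pair_measure_Times)
    also have "\<dots> = (\<Prod>i\<in>I. emeasure P (B i) * emeasure P (C i))"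
      using B C I by (simp add: emeasure_PiM prod.distrib)
    also have "\<dots> = (\<Prod>i\<in>I. emeasure P (A i))"
      by (rule prod.cong) (auto simp: B_def C_def emeasure_space_1)
    finally show "emeasure (distr (PiM I (\<lambda>_. P) \<Otimes>\<^sub>M PiM I (\<lambda>_. P)) (PiM I (\<lambda>_. P)) (\<lambda>(t, s). mix I e t s)) (PiE I A)
        = (\<Prod>i\<in>I. emeasure P (A i))" .
  qed simp
qed

section \<open>Sign patterns and their negation\<close>

definition sign_patterns :: "nat \<Rightarrow> (nat \<Rightarrow> real) set" where
  "sign_patterns N = PiE {..<N} (\<lambda>_. {-1, 1})"

text \<open>The restriction keeps the value outside the index range at \<open>undefined\<close>, so
  that negation is an involution of \<open>sign_patterns N\<close>.\<close>

definition neg_pattern :: "nat \<Rightarrow> (nat \<Rightarrow> real) \<Rightarrow> nat \<Rightarrow> real" where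
  "neg_pattern N e = (\<lambda>i\<in>{..<N}. - e i)"

lemma finite_sign_patterns: "finite (sign_patterns N)"
  unfolding sign_patterns_def by (intro finite_PiE) auto

lemma card_sign_patterns: "card (sign_patterns N) = 2 ^ N"
  unfolding sign_patterns_def by (simp add: card_PiE numeral_2_eq_2)

lemma neg_pattern_sign_patterns: "e \<in> sign_patterns N \<Longrightarrow> neg_pattern N e \<in> sign_patterns N"
  by (auto simp: sign_patterns_def neg_pattern_def PiE_iff)

lemma neg_neg_pattern: "e \<in> sign_patterns N \<Longrightarrow> neg_pattern N (neg_pattern N e) = e"
  by (auto simp: sign_patterns_def neg_pattern_def PiE_iff extensional_def)

lemma sum_neg_pattern:
  fixes f :: "(nat \<Rightarrow> real) \<Rightarrow> real"
  shows "(\<Sum>e\<in>sign_patterns N. f (neg_pattern N e)) = (\<Sum>e\<in>sign_patterns N. f e)"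
  by (rule sum.reindex_bij_witness[of _ "neg_pattern N" "neg_pattern N"])
     (auto simp: neg_neg_pattern neg_pattern_sign_patterns)

lemma sign_patterns_cases: "e \<in> sign_patterns N \<Longrightarrow> i < N \<Longrightarrow> e i = 1 \<or> e i = -1"
  by (auto simp: sign_patterns_def PiE_iff)

section \<open>Suprema of signed empirical means over a bounded class\<close>

text \<open>Here \<open>u g\<close> plays the role of the loss of the predictor \<open>g\<close> as
  a function of a data point. Symmetrization and concentration use only its range and measurability,
  not its form.\<close>

locale bounded_class = prob_space P for P :: "'a measure" +
  fixes G :: "'g set" and u :: "'g \<Rightarrow> 'a \<Rightarrow> real" and b :: real and N :: nat
  assumes N: "N \<ge> 1" and G: "G \<noteq> {}"
    and u_meas: "\<And>g. g \<in> G \<Longrightarrow> u g \<in> borel_measurable P"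
    and u_range: "\<And>g x. g \<in> G \<Longrightarrow> x \<in> space P \<Longrightarrow> 0 \<le> u g x \<and> u g x \<le> b"
    and sup_meas: "\<And>e. e \<in> sign_patterns N \<Longrightarrow>
      (\<lambda>s. SUP g\<in>G. ereal ((1 / real N) * (\<Sum>i<N. e i * u g (s i)))) \<in> borel_measurable (PiM {..<N} (\<lambda>_. P))"
begin

abbreviation "S \<equiv> PiM {..<N} (\<lambda>_. P)"

definition signed_mean :: "(nat \<Rightarrow> real) \<Rightarrow> 'g \<Rightarrow> (nat \<Rightarrow> 'a) \<Rightarrow> real" where
  "signed_mean e g s = (1 / real N) * (\<Sum>i<N. e i * u g (s i))"

definition signed_sup :: "(nat \<Rightarrow> real) \<Rightarrow> (nat \<Rightarrow> 'a) \<Rightarrow> real" where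
  "signed_sup e s = (SUP g\<in>G. signed_mean e g s)"

text \<open>The scalar Rademacher complexity of the class of losses, with the expectation over the
  signs written as a finite average.\<close>

definition rad :: real where
  "rad = (\<Sum>e\<in>sign_patterns N. \<integral>s. signed_sup e s \<partial>S) / 2 ^ N"

sublocale S: prob_space S
  by (intro prob_space_PiM prob_space_axioms)

sublocale SS: pair_prob_space S S
  by standard

lemma component_space: "s \<in> space S \<Longrightarrow> i < N \<Longrightarrow> s i \<in> space P"
  by (auto simp: space_PiM PiE_iff)

lemma b_nonneg: "b \<ge> 0"
proof -
  obtain g x where "g \<in> G" "x \<in> space P" using G not_empty by blast
  then show ?thesis using u_range[of g x] by auto
qed

lemma signed_mean_bound:
  assumes e: "e \<in> sign_patterns N" and g: "g \<in> G" and s: "s \<in> space S"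
  shows "\<bar>signed_mean e g s\<bar> \<le> b"
proof -
  have "\<bar>\<Sum>i<N. e i * u g (s i)\<bar> \<le> (\<Sum>i<N. \<bar>e i * u g (s i)\<bar>)"
    by (rule sum_abs)
  also have "\<dots> \<le> (\<Sum>i<N. b)"
  proof (rule sum_mono)
    fix i assume i: "i \<in> {..<N}"
    show "\<bar>e i * u g (s i)\<bar> \<le> b"
      using sign_patterns_cases[OF e, of i] u_range[OF g component_space[OF s], of i] i by auto
  qed
  finally show ?thesis
    using N by (simp add: signed_mean_def abs_mult field_simps)
qed

lemma signed_mean_bdd:
  "e \<in> sign_patterns N \<Longrightarrow> s \<in> space S \<Longrightarrow> bdd_above ((\<lambda>g. signed_mean e g s) ` G)"
  using signed_mean_bound by (intro bdd_aboveI2[where M=b]) (metis abs_le_D1)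

lemma signed_sup_upper:
  "e \<in> sign_patterns N \<Longrightarrow> s \<in> space S \<Longrightarrow> g \<in> G \<Longrightarrow> signed_mean e g s \<le> signed_sup e s"
  unfolding signed_sup_def by (intro cSUP_upper signed_mean_bdd)

lemma signed_sup_least:
  "(\<And>g. g \<in> G \<Longrightarrow> signed_mean e g s \<le> x) \<Longrightarrow> signed_sup e s \<le> x"
  unfolding signed_sup_def using G by (intro cSUP_least)

lemma signed_sup_bound:
  assumes e: "e \<in> sign_patterns N" and s: "s \<in> space S"
  shows "\<bar>signed_sup e s\<bar> \<le> b"
proof -
  obtain g where g: "g \<in> G" using G by blast
  have "- b \<le> signed_sup e s"
    using signed_mean_bound[OF e g s] signed_sup_upper[OF e s g] by linarith
  moreover have "signed_sup e s \<le> b"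
    using signed_mean_bound[OF e _ s] by (intro signed_sup_least) (metis abs_le_D1)
  ultimately show ?thesis by linarith
qed

text \<open>The locale assumption concerns the supremum in the extended reals. Boundedness makes
  that supremum finite, so its real part is the real supremum.\<close>

lemma signed_sup_meas:
  assumes e: "e \<in> sign_patterns N"
  shows "signed_sup e \<in> borel_measurable S"
proof -
  let ?f = "\<lambda>s. SUP g\<in>G. ereal (signed_mean e g s)"
  have "(\<lambda>s. real_of_ereal (?f s)) \<in> borel_measurable S"
    using sup_meas[OF e] by (simp add: signed_mean_def)
  moreover have "real_of_ereal (?f s) = signed_sup e s" if s: "s \<in> space S" for s
  proof -
    obtain g where g: "g \<in> G" using G by blast
    have "?f s \<le> ereal b"
      using signed_mean_bound[OF e _ s] by (intro SUP_least) (auto simp: abs_le_iff)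
    moreover have "ereal (signed_mean e g s) \<le> ?f s"
      using g by (rule SUP_upper)
    ultimately have "\<bar>?f s\<bar> \<noteq> \<infinity>" by (cases "?f s") auto
    then have "ereal (signed_sup e s) = ?f s"
      unfolding signed_sup_def by (rule ereal_SUP)
    then show ?thesis by (metis real_of_ereal.simps(1))
  qed
  ultimately show ?thesis
    by (subst measurable_cong[where g = "\<lambda>s. real_of_ereal (?f s)"]) auto
qed

lemma signed_sup_integrable: "e \<in> sign_patterns N \<Longrightarrow> integrable S (signed_sup e)"
  using signed_sup_bound signed_sup_meas by (intro S.integrable_const_bound[of _ b] AE_I2) auto

text \<open>Only the \<open>i\<close>-th term of each signed mean differs. For a fixed sign it
  ranges over an interval of length \<open>b\<close>, before division by \<open>N\<close>, which is
  why the bound is \<open>b / N\<close> and not twice that.\<close>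

lemma signed_sup_change:
  assumes e: "e \<in> sign_patterns N" and s: "s \<in> space S" "s' \<in> space S"
    and i: "i < N" and eq: "\<And>j. j < N \<Longrightarrow> j \<noteq> i \<Longrightarrow> s j = s' j"
  shows "\<bar>signed_sup e s - signed_sup e s'\<bar> \<le> b / N"
proof -
  have *: "signed_sup e s \<le> signed_sup e s' + b / N"
    if s: "s \<in> space S" "s' \<in> space S" and eq: "\<And>j. j < N \<Longrightarrow> j \<noteq> i \<Longrightarrow> s j = s' j" for s s'
  proof (rule signed_sup_least)
    fix g assume g: "g \<in> G"
    have split: "signed_mean e g t = (1 / N) * (e i * u g (t i)) + (1 / N) * (\<Sum>j\<in>{..<N} - {i}. e j * u g (t j))" for t
      unfolding signed_mean_def using i by (subst sum.remove[of _ i]) (auto simp: algebra_simps)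
    have "(\<Sum>j\<in>{..<N} - {i}. e j * u g (s j)) = (\<Sum>j\<in>{..<N} - {i}. e j * u g (s' j))"
      by (rule sum.cong) (auto simp: eq)
    moreover have "e i * u g (s i) \<le> e i * u g (s' i) + b"
      using sign_patterns_cases[OF e i] u_range[OF g component_space[OF s(1) i]]
        u_range[OF g component_space[OF s(2) i]] by auto
    then have "(1 / N) * (e i * u g (s i)) \<le> (1 / N) * (e i * u g (s' i) + b)"
      by (rule mult_left_mono) simp
    then have "(1 / N) * (e i * u g (s i)) \<le> (1 / N) * (e i * u g (s' i)) + b / N"
      by (simp add: algebra_simps)
    ultimately have "signed_mean e g s \<le> signed_mean e g s' + b / N"
      unfolding split by simp
    also have "\<dots> \<le> signed_sup e s' + b / N"
      using signed_sup_upper[OF e s(2) g] by simp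
    finally show "signed_mean e g s \<le> signed_sup e s' + b / N" .
  qed
  from *[OF s eq] *[OF s(2,1)] eq show ?thesis by force
qed

text \<open>For one fixed \<open>g\<close> the signed means of opposite patterns cancel. The
  nonnegativity holds for each sample, which later allows passing to \<open>ennreal\<close> without
  truncation.\<close>

lemma sum_signed_sup_nonneg:
  assumes s: "s \<in> space S"
  shows "(\<Sum>e\<in>sign_patterns N. signed_sup e s) \<ge> 0"
proof -
  obtain g where g: "g \<in> G" using G by blast
  have "signed_mean (neg_pattern N e) g s = - signed_mean e g s" for e
    by (simp add: signed_mean_def neg_pattern_def sum_negf)
  then have "(\<Sum>e\<in>sign_patterns N. signed_mean e g s) = 0"
    using sum_neg_pattern[of "\<lambda>e. signed_mean e g s" N] by (simp add: sum_negf)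
  moreover have "(\<Sum>e\<in>sign_patterns N. signed_mean e g s) \<le> (\<Sum>e\<in>sign_patterns N. signed_sup e s)"
    by (intro sum_mono signed_sup_upper s g)
  ultimately show ?thesis by simp
qed

lemma rad_eq: "rad = (\<integral>s. (\<Sum>e\<in>sign_patterns N. signed_sup e s) / 2 ^ N \<partial>S)"
  using signed_sup_integrable by (simp add: rad_def Bochner_Integration.integral_sum)

lemma rad_nonneg: "rad \<ge> 0"
  unfolding rad_eq using sum_signed_sup_nonneg by (intro Bochner_Integration.integral_nonneg) auto

section \<open>Averaging over the ghost sample\<close>

definition mixed :: "(nat \<Rightarrow> real) \<Rightarrow> (nat \<Rightarrow> 'a) \<Rightarrow> real" where
  "mixed e s = (\<integral>t. signed_sup e (mix {..<N} e t s) \<partial>S)"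

lemma mixed_meas2:
  assumes e: "e \<in> sign_patterns N"
  shows "(\<lambda>(t, s). signed_sup e (mix {..<N} e t s)) \<in> borel_measurable (S \<Otimes>\<^sub>M S)"
  using measurable_compose[OF measurable_mix signed_sup_meas[OF e]] by (simp add: case_prod_beta)

lemma mixed_integrable2:
  assumes e: "e \<in> sign_patterns N"
  shows "integrable (S \<Otimes>\<^sub>M S) (\<lambda>(t, s). signed_sup e (mix {..<N} e t s))"
  using mixed_meas2[OF e] signed_sup_bound[OF e mix_space]
  by (intro SS.P.integrable_const_bound[of _ b] AE_I2) (auto simp: space_pair_measure)

lemma mixed_integrable1:
  assumes e: "e \<in> sign_patterns N" and s: "s \<in> space S"
  shows "integrable S (\<lambda>t. signed_sup e (mix {..<N} e t s))"
proof (intro S.integrable_const_bound[of _ b] AE_I2)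
  show "(\<lambda>t. signed_sup e (mix {..<N} e t s)) \<in> borel_measurable S"
    using measurable_compose[OF measurable_Pair2' mixed_meas2[OF e]] s by auto
qed (use signed_sup_bound[OF e mix_space] s in auto)

lemma mixed_meas:
  assumes e: "e \<in> sign_patterns N"
  shows "mixed e \<in> borel_measurable S"
proof -
  have "(\<lambda>(s, t). signed_sup e (mix {..<N} e t s)) \<in> borel_measurable (S \<Otimes>\<^sub>M S)"
    using measurable_compose[OF measurable_pair_swap' mixed_meas2[OF e]] by (simp add: case_prod_beta)
  then show ?thesis
    unfolding mixed_def by (rule S.borel_measurable_lebesgue_integral)
qed

lemma mixed_bound:
  assumes e: "e \<in> sign_patterns N" and s: "s \<in> space S"
  shows "\<bar>mixed e s\<bar> \<le> b"
proof -
  have "\<bar>mixed e s\<bar> \<le> (\<integral>t. \<bar>signed_sup e (mix {..<N} e t s)\<bar> \<partial>S)"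
    unfolding mixed_def by (rule integral_abs_bound)
  also have "\<dots> \<le> b"
    using mixed_integrable1[OF e s] signed_sup_bound[OF e mix_space] s
    by (intro S.integral_le_const AE_I2) auto
  finally show ?thesis .
qed

text \<open>By Fubini this is an expectation over two independent samples, and the mixed sample has
  the law of a single one.\<close>

lemma integral_mixed:
  assumes e: "e \<in> sign_patterns N"
  shows "(\<integral>s. mixed e s \<partial>S) = (\<integral>s. signed_sup e s \<partial>S)"
proof -
  have "(\<integral>s. mixed e s \<partial>S) = (\<integral>p. (case p of (t, s) \<Rightarrow> signed_sup e (mix {..<N} e t s)) \<partial>(S \<Otimes>\<^sub>M S))"
    unfolding mixed_def using mixed_integrable2[OF e] by (rule SS.integral_snd)
  also have "\<dots> = (\<integral>s. signed_sup e s \<partial>distr (S \<Otimes>\<^sub>M S) S (\<lambda>(t, s). mix {..<N} e t s))"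
    by (subst integral_distr[OF measurable_mix signed_sup_meas[OF e]]) (simp add: case_prod_beta')
  also have "\<dots> = (\<integral>s. signed_sup e s \<partial>S)"
    by (subst distr_mix) (auto intro: prob_space_axioms)
  finally show ?thesis .
qed

lemma upd_space: "s \<in> space S \<Longrightarrow> i < N \<Longrightarrow> y \<in> space P \<Longrightarrow> s(i := y) \<in> space S"
  by (auto simp: space_PiM PiE_iff extensional_def)

text \<open>At a coordinate with sign 1 the mixed sample takes the ghost point, so the observed
  point there is never seen.\<close>

lemma mixed_change_eq:
  assumes "e i = 1"
  shows "mixed e (s(i := y)) = mixed e s"
proof -
  have "mix {..<N} e t (s(i := y)) = mix {..<N} e t s" for t
    using assms by (auto simp: mix_def)
  then show ?thesis by (simp only: mixed_def)
qed

lemma mixed_change: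
  assumes e: "e \<in> sign_patterns N" and s: "s \<in> space S" and i: "i < N" and y: "y \<in> space P"
  shows "\<bar>mixed e (s(i := y)) - mixed e s\<bar> \<le> b / N"
proof -
  let ?f = "\<lambda>s t. signed_sup e (mix {..<N} e t s)"
  note s' = upd_space[OF s i y]
  have int: "integrable S (?f s)" "integrable S (?f (s(i := y)))"
    using mixed_integrable1[OF e] s s' by auto
  have "\<bar>mixed e (s(i := y)) - mixed e s\<bar> = \<bar>\<integral>t. ?f (s(i := y)) t - ?f s t \<partial>S\<bar>"
    unfolding mixed_def using int by simp
  also have "\<dots> \<le> (\<integral>t. \<bar>?f (s(i := y)) t - ?f s t\<bar> \<partial>S)"
    by (rule integral_abs_bound)
  also have "\<dots> \<le> b / N"
  proof (rule S.integral_le_const)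
    show "integrable S (\<lambda>t. \<bar>?f (s(i := y)) t - ?f s t\<bar>)"
      by (intro integrable_abs Bochner_Integration.integrable_diff int)
    have "\<bar>?f (s(i := y)) t - ?f s t\<bar> \<le> b / N" if t: "t \<in> space S" for t
    proof (rule signed_sup_change[OF e mix_space[OF t s'] mix_space[OF t s] i])
      show "mix {..<N} e t (s(i := y)) j = mix {..<N} e t s j" if "j < N" "j \<noteq> i" for j
        using that by (simp add: mix_def)
    qed
    then show "AE t in S. \<bar>?f (s(i := y)) t - ?f s t\<bar> \<le> b / N"
      by (intro AE_I2)
  qed
  finally show ?thesis .
qed

lemma u_integrable: "g \<in> G \<Longrightarrow> integrable P (u g)"
  using u_range u_meas b_nonneg by (intro integrable_const_bound[of _ b] AE_I2) (auto simp: abs_le_iff)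

lemma
  assumes g: "g \<in> G"
  shows mean_integrable: "integrable S (\<lambda>s. (1 / N) * (\<Sum>i<N. u g (s i)))"
    and integral_mean: "(\<integral>s. (1 / N) * (\<Sum>i<N. u g (s i)) \<partial>S) = (\<integral>x. u g x \<partial>P)"
proof -
  interpret product_prob_space "\<lambda>_. P" "{..<N}"
    by (intro product_prob_spaceI prob_space_axioms)
  have distr: "distr S P (\<lambda>s. s i) = P" if "i < N" for i
    using PiM_component[of i] that by simp
  have int: "integrable S (\<lambda>s. u g (s i))" if i: "i < N" for i
    using u_integrable[OF g] i by (subst (asm) distr[OF i, symmetric]) (rule integrable_distr, auto)
  then show "integrable S (\<lambda>s. (1 / N) * (\<Sum>i<N. u g (s i)))"
    by (intro integrable_mult_right Bochner_Integration.integrable_sum) auto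
  have "(\<integral>s. u g (s i) \<partial>S) = (\<integral>x. u g x \<partial>P)" if i: "i < N" for i
    using i by (subst (2) distr[OF i, symmetric], subst integral_distr) (auto simp: u_meas[OF g])
  then show "(\<integral>s. (1 / N) * (\<Sum>i<N. u g (s i)) \<partial>S) = (\<integral>x. u g x \<partial>P)"
    using int N by (simp add: Bochner_Integration.integral_sum)
qed

text \<open>The supremum over the class of the deviations on the left-hand side need not be measurable.
  Its majorant on the right-hand side is, since exchanging the sample points \<open>i\<close> with
  \<open>e i = -1\<close> turns the deviation of the two samples into signed means of mixed samples.\<close>

lemma deviation_le_mixed:
  assumes e: "e \<in> sign_patterns N" and g: "g \<in> G" and s: "s \<in> space S"
  shows "(\<integral>x. u g x \<partial>P) - (1 / N) * (\<Sum>i<N. u g (s i)) \<le> mixed e s + mixed (neg_pattern N e) s"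
proof -
  let ?n = "neg_pattern N e"
  note n = neg_pattern_sign_patterns[OF e]
  have pt: "(1 / N) * (\<Sum>i<N. u g (t i)) - (1 / N) * (\<Sum>i<N. u g (s i))
      \<le> signed_sup e (mix {..<N} e t s) + signed_sup ?n (mix {..<N} ?n t s)" if t: "t \<in> space S" for t
  proof -
    \<comment> \<open>Where \<open>e i = 1\<close>, the pattern \<open>e\<close> contributes the
      ghost loss with sign plus and \<open>?n\<close> the observed loss with sign minus; where
      \<open>e i = -1\<close> the two patterns exchange these roles.\<close>
    have "(\<Sum>i<N. u g (t i) - u g (s i))
        = (\<Sum>i<N. e i * u g (mix {..<N} e t s i) + ?n i * u g (mix {..<N} ?n t s i))"
    proof (rule sum.cong)
      fix i assume "i \<in> {..<N}"
      then show "u g (t i) - u g (s i) = e i * u g (mix {..<N} e t s i) + ?n i * u g (mix {..<N} ?n t s i)"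
        using sign_patterns_cases[OF e, of i] by (auto simp: mix_def neg_pattern_def)
    qed simp
    then have "(1 / N) * (\<Sum>i<N. u g (t i)) - (1 / N) * (\<Sum>i<N. u g (s i))
      = signed_mean e g (mix {..<N} e t s) + signed_mean ?n g (mix {..<N} ?n t s)"
      by (simp add: signed_mean_def sum_subtractf sum.distrib flip: diff_divide_distrib add_divide_distrib)
    also have "\<dots> \<le> signed_sup e (mix {..<N} e t s) + signed_sup ?n (mix {..<N} ?n t s)"
      by (intro add_mono signed_sup_upper e n g mix_space s t)
    finally show ?thesis .
  qed
  \<comment> \<open>The risk is the expected empirical risk of the ghost sample, so the pointwise
    bound is integrated over \<open>t\<close>.\<close>
  have "(\<integral>x. u g x \<partial>P) - (1 / N) * (\<Sum>i<N. u g (s i))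
      = (\<integral>t. (1 / N) * (\<Sum>i<N. u g (t i)) - (1 / N) * (\<Sum>i<N. u g (s i)) \<partial>S)"
    using mean_integrable[OF g] integral_mean[OF g]
    by (subst Bochner_Integration.integral_diff) (auto simp: S.prob_space)
  also have "\<dots> \<le> (\<integral>t. signed_sup e (mix {..<N} e t s) + signed_sup ?n (mix {..<N} ?n t s) \<partial>S)"
    using mixed_integrable1[OF e s] mixed_integrable1[OF n s] mean_integrable[OF g] pt
    by (intro integral_mono) auto
  also have "\<dots> = mixed e s + mixed ?n s"
    unfolding mixed_def using mixed_integrable1[OF e s] mixed_integrable1[OF n s] by simp
  finally show ?thesis .
qed

text \<open>The event is fixed before the minimizer and serves all empirical minimizers at once, so
  the data-dependent choice of one need not be measurable.\<close>

lemma excess_risk_bound: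
  assumes \<delta>: "0 < \<delta>" "\<delta> < 1"
  shows "\<exists>A\<in>sets S. measure S A \<ge> 1 - \<delta> \<and> (\<forall>s\<in>A. \<forall>g\<in>G.
     (\<forall>g'\<in>G. (\<Sum>i<N. u g (s i)) \<le> (\<Sum>i<N. u g' (s i))) \<longrightarrow>
     (\<integral>x. u g x \<partial>P) - (INF g\<in>G. \<integral>x. u g x \<partial>P) \<le> 2 * rad + b * sqrt (2 * ln (2 / \<delta>) / N))"
proof (cases "b = 0")
  case True
  \<comment> \<open>With \<open>b = 0\<close> all losses vanish. The case is separate because
    \<open>mcdiarmid\<close> asks for a positive difference constant.\<close>
  have 0: "(\<integral>x. u g x \<partial>P) = 0" if g: "g \<in> G" for g
  proof -
    have "u g x = 0" if "x \<in> space P" for x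
      using u_range[OF g that] True by simp
    then have "(\<integral>x. u g x \<partial>P) = (\<integral>x. 0 \<partial>P)"
      by (intro Bochner_Integration.integral_cong) auto
    then show ?thesis by simp
  qed
  have "(INF g\<in>G. \<integral>x. u g x \<partial>P) = (INF g\<in>G. 0 :: real)"
    using 0 by (intro INF_cong) auto
  then have 1: "(INF g\<in>G. \<integral>x. u g x \<partial>P) = 0" using G by simp
  show ?thesis
    using rad_nonneg \<delta> True 1 by (intro bexI[of _ "space S"]) (simp_all add: S.prob_space 0)
next
  case False
  then have b: "b > 0" using b_nonneg by simp
  define R where "R = (INF g\<in>G. \<integral>x. u g x \<partial>P)"
  \<comment> \<open>Negation permutes the patterns, so the average of the left-hand side over all
    \<open>e\<close> is exactly \<open>2 * rad\<close>; some pattern is no worse than the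
    average.\<close>
  have "\<exists>e\<in>sign_patterns N.
    (\<integral>s. signed_sup e s \<partial>S) + (\<integral>s. signed_sup (neg_pattern N e) s \<partial>S) \<le> 2 * rad"
  proof (rule ccontr)
    assume "\<not> ?thesis"
    then have "\<And>e. e \<in> sign_patterns N \<Longrightarrow>
      2 * rad < (\<integral>s. signed_sup e s \<partial>S) + (\<integral>s. signed_sup (neg_pattern N e) s \<partial>S)"
      by (simp add: not_le)
    then have "(\<Sum>e\<in>sign_patterns N. 2 * rad)
        < (\<Sum>e\<in>sign_patterns N. (\<integral>s. signed_sup e s \<partial>S) + (\<integral>s. signed_sup (neg_pattern N e) s \<partial>S))"
      using finite_sign_patterns card_sign_patterns[of N] by (intro sum_strict_mono) auto
    also have "\<dots> = 2 * (\<Sum>e\<in>sign_patterns N. \<integral>s. signed_sup e s \<partial>S)"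
      using sum_neg_pattern[of "\<lambda>e. \<integral>s. signed_sup e s \<partial>S" N] by (simp add: sum.distrib)
    finally show False by (simp add: rad_def card_sign_patterns)
  qed
  then obtain e where e: "e \<in> sign_patterns N"
    and e_le: "(\<integral>s. signed_sup e s \<partial>S) + (\<integral>s. signed_sup (neg_pattern N e) s \<partial>S) \<le> 2 * rad"
    by blast
  define n where "n = neg_pattern N e"
  \<comment> \<open>With all signs -1, \<open>signed_sup m\<close> is minus the infimum of the
    empirical risk over \<open>G\<close>, and its measurability is covered by the assumption on
    signed suprema.\<close>
  define m :: "nat \<Rightarrow> real" where "m = (\<lambda>i\<in>{..<N}. -1)"
  have n: "n \<in> sign_patterns N" unfolding n_def by (rule neg_pattern_sign_patterns[OF e])
  have m: "m \<in> sign_patterns N" by (auto simp: m_def sign_patterns_def)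
  have m_mean: "signed_mean m g s = - ((1 / N) * (\<Sum>i<N. u g (s i)))" for g s
    by (simp add: signed_mean_def m_def sum_negf)
  \<comment> \<open>At an empirical minimizer the empirical risk is \<open>- signed_sup m s\<close>,
    so \<open>f\<close> dominates its excess risk without referring to which minimizer is
    chosen.\<close>
  define f where "f s = mixed e s + mixed n s - signed_sup m s - R" for s
  have f_meas: "f \<in> borel_measurable S"
    unfolding f_def[abs_def]
    by (intro borel_measurable_add borel_measurable_diff mixed_meas[OF e] mixed_meas[OF n]
        signed_sup_meas[OF m] borel_measurable_const)
  have f_bnd: "\<bar>f s\<bar> \<le> 3 * b + \<bar>R\<bar>" if s: "s \<in> space S" for s
    using mixed_bound[OF e s] mixed_bound[OF n s] signed_sup_bound[OF m s] unfolding f_def by linarith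
  have f_diff: "\<bar>f (s(i := y)) - f s\<bar> \<le> 2 * b / N"
    if s: "s \<in> space S" and i: "i \<in> {..<N}" and y: "y \<in> space P" for s i y
  proof -
    from i have i: "i < N" by simp
    have "\<bar>signed_sup m (s(i := y)) - signed_sup m s\<bar> \<le> b / N"
      by (rule signed_sup_change[OF m upd_space[OF s i y] s i]) auto
    \<comment> \<open>Of \<open>mixed e\<close> and \<open>mixed n\<close> exactly one can depend on
      the \<open>i\<close>-th observed point, so their sum moves by \<open>b / N\<close> only.
      Together with \<open>signed_sup m\<close> this gives \<open>2 * b / N\<close>.\<close>
    moreover have "\<bar>(mixed e (s(i := y)) + mixed n (s(i := y))) - (mixed e s + mixed n s)\<bar> \<le> b / N"
    proof (cases "e i = 1")
      case True
      then show ?thesis using mixed_change[OF n s i y] by (simp add: mixed_change_eq)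
    next
      case False
      then have "n i = 1" using sign_patterns_cases[OF e i] i by (auto simp: n_def neg_pattern_def)
      then show ?thesis using mixed_change[OF e s i y] by (simp add: mixed_change_eq)
    qed
    moreover have "2 * b / N = b / N + b / N" by simp
    ultimately show ?thesis unfolding f_def by linarith
  qed
  have mixed_int: "integrable S (mixed e')" if e': "e' \<in> sign_patterns N" for e'
    using mixed_bound[OF e'] mixed_meas[OF e'] by (intro S.integrable_const_bound[of _ b] AE_I2) auto
  \<comment> \<open>The expected infimum of the empirical risk is at most the infimum of the risk,
    so the last two terms of \<open>f\<close> add nothing positive to its mean.\<close>
  have R_ge: "- (\<integral>s. signed_sup m s \<partial>S) \<le> R"
    unfolding R_def
  proof (rule cINF_greatest[OF G])
    fix g assume g: "g \<in> G"
    have "(\<integral>s. signed_sup m s \<partial>S) \<ge> (\<integral>s. - ((1 / N) * (\<Sum>i<N. u g (s i))) \<partial>S)"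
      using signed_sup_integrable[OF m] mean_integrable[OF g] signed_sup_upper[OF m _ g]
      by (intro integral_mono) (auto simp: m_mean)
    then show "- (\<integral>s. signed_sup m s \<partial>S) \<le> (\<integral>x. u g x \<partial>P)"
      using integral_mean[OF g] by simp
  qed
  have f_mean: "(\<integral>s. f s \<partial>S) \<le> 2 * rad"
  proof -
    have "(\<integral>s. f s \<partial>S) = (\<integral>s. mixed e s \<partial>S) + (\<integral>s. mixed n s \<partial>S) - (\<integral>s. signed_sup m s \<partial>S) - R"
      unfolding f_def using mixed_int[OF e] mixed_int[OF n] signed_sup_integrable[OF m]
      by (simp add: S.prob_space)
    then show ?thesis
      using e_le R_ge integral_mixed[OF e] integral_mixed[OF n] by (simp add: n_def)
  qed
  \<comment> \<open>Chosen so that the McDiarmid exponent with difference constant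
    \<open>2 * b / N\<close> equals \<open>- ln (2 / \<delta>)\<close>. The failure probability is
    then at most \<open>\<delta> / 2\<close>.\<close>
  define t where "t = b * sqrt (2 * ln (2 / \<delta>) / N)"
  have ln: "ln (2 / \<delta>) > 0" using \<delta> by simp
  have t: "t > 0" using b ln N by (simp add: t_def)
  define A where "A = {s \<in> space S. \<not> f s - (\<integral>t. f t \<partial>S) \<ge> t}"
  note f_meas[measurable]
  have A: "A \<in> sets S" unfolding A_def by measurable
  have "measure S {s \<in> space S. f s - (\<integral>t. f t \<partial>S) \<ge> t}
      \<le> exp (- 2 * t\<^sup>2 / (card {..<N} * (2 * b / N)\<^sup>2))"
  proof (rule mcdiarmid[where f = f and I = "{..<N}" and P = P and c = "2 * b / N" and K = "3 * b + \<bar>R\<bar>"])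
    show "2 * b / N > 0" "t > 0" using N b t by auto
    show "{..<N} \<noteq> {}" using N by (auto simp: lessThan_empty_iff)
    show "\<bar>f s\<bar> \<le> 3 * b + \<bar>R\<bar>" if "s \<in> space S" for s
      using that by (rule f_bnd)
    show "\<bar>f (s(i := y)) - f s\<bar> \<le> 2 * b / N" if "s \<in> space S" "i \<in> {..<N}" "y \<in> space P" for s i y
      using that by (rule f_diff)
  qed (rule prob_space_axioms finite_lessThan f_meas)+
  also have "- 2 * t\<^sup>2 / (card {..<N} * (2 * b / N)\<^sup>2) = - ln (2 / \<delta>)"
  proof -
    have "t\<^sup>2 = b\<^sup>2 * (2 * ln (2 / \<delta>) / N)"
      using ln by (simp add: t_def power_mult_distrib )
    moreover have "- 2 * (b\<^sup>2 * (2 * l / N)) / (N * (2 * b / N)\<^sup>2) = - l" for l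
      using b N by (simp add: power2_eq_square)
    ultimately show ?thesis by simp
  qed
  also have "exp (- ln (2 / \<delta>)) = \<delta> / 2"
    using \<delta> by (simp add: exp_minus)
  finally have "measure S {s \<in> space S. f s - (\<integral>t. f t \<partial>S) \<ge> t} \<le> \<delta>" using \<delta> by simp
  moreover have "measure S A = 1 - measure S {s \<in> space S. f s - (\<integral>t. f t \<partial>S) \<ge> t}"
    unfolding A_def by (intro S.prob_neg) measurable
  ultimately have "measure S A \<ge> 1 - \<delta>" by simp
  moreover have "(\<integral>x. u g x \<partial>P) - R \<le> 2 * rad + t"
    if s: "s \<in> A" and g: "g \<in> G" and min: "\<And>g'. g' \<in> G \<Longrightarrow> (\<Sum>i<N. u g (s i)) \<le> (\<Sum>i<N. u g' (s i))" for s g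
  proof -
    have sS: "s \<in> space S" and fs: "f s < (\<integral>t. f t \<partial>S) + t" using s by (auto simp: A_def)
    have "signed_sup m s \<le> - ((1 / N) * (\<Sum>i<N. u g (s i)))"
      using min N by (intro signed_sup_least) (auto simp: m_mean divide_right_mono)
    then show ?thesis
      using deviation_le_mixed[OF e g sS] fs f_mean by (simp add: f_def n_def)
  qed
  ultimately show ?thesis
    unfolding R_def[symmetric] t_def[symmetric] using A by (intro bexI[of _ A] conjI ballI impI) simp_all
qed

end

section \<open>From losses to predictors\<close>

text \<open>Contraction for one fixed sample, where \<open>w i g\<close> is the loss of
  \<open>g\<close> at the \<open>i\<close>-th point. The suprema for the predictors may be infinite,
  so their negative parts stand on the left and their positive parts on the right, and nothing has
  to be subtracted.\<close>

lemma contraction_rademacher_sup: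
  fixes G :: "(real^'p \<Rightarrow> real^'d) set" and x :: "nat \<Rightarrow> real^'p"
    and w :: "nat \<Rightarrow> (real^'p \<Rightarrow> real^'d) \<Rightarrow> real"
  assumes G: "G \<noteq> {}" and L: "L \<ge> 0"
    and lip: "\<And>i g g'. i < N \<Longrightarrow> g \<in> G \<Longrightarrow> g' \<in> G \<Longrightarrow> \<bar>w i g - w i g'\<bar> \<le> L * norm (g (x i) - g' (x i))"
    and bdd: "\<And>e. e \<in> sign_patterns N \<Longrightarrow> bdd_above ((\<lambda>g. (1 / real N) * (\<Sum>i<N. e i * w i g)) ` G)"
    and nonneg: "(\<Sum>e\<in>sign_patterns N. SUP g\<in>G. (1 / real N) * (\<Sum>i<N. e i * w i g)) \<ge> 0"
  defines "q \<equiv> ennreal (1 / card (sign_vectors :: (real^'d) set)) ^ N"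
  shows "ennreal ((\<Sum>e\<in>sign_patterns N. SUP g\<in>G. (1 / real N) * (\<Sum>i<N. e i * w i g)) / 2 ^ N)
      + ennreal (2 * L) * ((\<Sum>\<sigma>\<in>PiE {..<N} (\<lambda>_. sign_vectors). e2ennreal (- rademacher_sup N G (x, \<sigma>))) * q)
    \<le> ennreal (2 * L) * ((\<Sum>\<sigma>\<in>PiE {..<N} (\<lambda>_. sign_vectors). e2ennreal (rademacher_sup N G (x, \<sigma>))) * q)"
proof (rule ennreal_le_epsilon)
  fix \<eta> :: real assume \<eta>: "\<eta> > 0"
  define f where "f e g = (1 / real N) * (\<Sum>i<N. e i * w i g)" for e :: "nat \<Rightarrow> real" and g
  define a where "a = (\<Sum>e\<in>sign_patterns N. SUP g\<in>G. f e g) / 2 ^ N"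
  define \<Sigma> :: "(nat \<Rightarrow> real^'d) set" where "\<Sigma> = PiE {..<N} (\<lambda>_. sign_vectors)"
  define c where "c = (1 / real (card (sign_vectors :: (real^'d) set))) ^ N"
  have c: "c \<ge> 0" "q = ennreal c" by (auto simp: c_def q_def ennreal_power)
  have fin: "finite \<Sigma>" unfolding \<Sigma>_def by (intro finite_PiE finite_sign_vectors) auto
  have a: "a \<ge> 0" using nonneg by (simp add: a_def f_def)
  \<comment> \<open>One near-maximizer for each of the finitely many patterns yields a finite
    subclass \<open>T\<close> that loses at most \<open>\<eta>\<close>, to which the contraction for
    maxima applies.\<close>
  have "\<exists>g\<in>G. (SUP g\<in>G. f e g) - \<eta> < f e g" if e: "e \<in> sign_patterns N" for e
    using less_cSUP_iff[OF G bdd[OF e], of "(SUP g\<in>G. f e g) - \<eta>"] \<eta> by (simp add: f_def)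
  then obtain k where k: "\<And>e. e \<in> sign_patterns N \<Longrightarrow> k e \<in> G \<and> (SUP g\<in>G. f e g) - \<eta> < f e (k e)"
    by metis
  define T where "T = k ` sign_patterns N"
  have "(\<lambda>i\<in>{..<N}. 1) \<in> sign_patterns N" by (auto simp: sign_patterns_def)
  then have T: "finite T" "T \<noteq> {}" "T \<subseteq> G"
    using k finite_sign_patterns by (auto simp: T_def)
  define m where "m \<sigma> g = (1 / real N) * (\<Sum>i<N. \<sigma> i \<bullet> g (x i))" for \<sigma> :: "nat \<Rightarrow> real^'d" and g
  define \<mu> where "\<mu> \<sigma> = Max (m \<sigma> ` T)" for \<sigma>
  have "a \<le> (\<Sum>e\<in>sign_patterns N. Max (f e ` T) + \<eta>) / 2 ^ N"
    unfolding a_def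
  proof (intro divide_right_mono sum_mono)
    fix e assume e: "e \<in> sign_patterns N"
    have "f e (k e) \<le> Max (f e ` T)"
      using T e by (intro Max_ge) (auto simp: T_def)
    then show "(SUP g\<in>G. f e g) \<le> Max (f e ` T) + \<eta>"
      using k[OF e] by simp
  qed simp
  also have "\<dots> = (\<Sum>e\<in>sign_patterns N. Max (f e ` T)) / 2 ^ N + \<eta>"
    by (simp add: sum.distrib card_sign_patterns add_divide_distrib)
  also have "(\<Sum>e\<in>sign_patterns N. Max (f e ` T)) / 2 ^ N
      = (\<Sum>e\<in>PiE {..<N} (\<lambda>_. {-1, 1}). Max ((\<lambda>g. 0 + (\<Sum>i<N. e i * (w i g / N))) ` T)) / 2 ^ card {..<N}"
    by (simp add: sign_patterns_def f_def[abs_def] sum_divide_distrib)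
  also have "\<dots> \<le> (\<Sum>\<sigma>\<in>PiE {..<N} (\<lambda>_. sign_vectors).
        Max ((\<lambda>g. 0 + (\<Sum>i<N. 2 * L * (\<sigma> i \<bullet> ((1 / N) *\<^sub>R g (x i))))) ` T))
      / card (sign_vectors :: (real^'d) set) ^ card {..<N}"
  proof (rule vector_contraction_Max[OF finite_lessThan T(1,2) _ L])
    fix i g g' assume "i \<in> {..<N}" "g \<in> T" "g' \<in> T"
    then have "\<bar>w i g - w i g'\<bar> / N \<le> L * norm (g (x i) - g' (x i)) / N"
      using T(3) by (intro divide_right_mono lip) auto
    then show "\<bar>w i g / N - w i g' / N\<bar> \<le> L * norm ((1 / N) *\<^sub>R g (x i) - (1 / N) *\<^sub>R g' (x i))"
      by (simp flip: diff_divide_distrib scaleR_diff_right)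
  qed
  also have "\<dots> = c * (\<Sum>\<sigma>\<in>\<Sigma>. 2 * L * \<mu> \<sigma>)"
  proof -
    have "Max ((\<lambda>g. 0 + (\<Sum>i<N. 2 * L * (\<sigma> i \<bullet> ((1 / N) *\<^sub>R g (x i))))) ` T) = 2 * L * \<mu> \<sigma>" for \<sigma>
    proof -
      have "mono (\<lambda>z. 2 * L * z)" using L by (intro monoI mult_left_mono) auto
      then have "2 * L * \<mu> \<sigma> = Max ((\<lambda>z. 2 * L * z) ` m \<sigma> ` T)"
        unfolding \<mu>_def using T by (intro mono_Max_commute) auto
      also have "(\<lambda>z. 2 * L * z) ` m \<sigma> ` T = (\<lambda>g. 0 + (\<Sum>i<N. 2 * L * (\<sigma> i \<bullet> ((1 / N) *\<^sub>R g (x i))))) ` T"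
        by (simp add: image_image m_def sum_distrib_left sum_divide_distrib)
      finally show ?thesis by simp
    qed
    then show ?thesis by (simp add: c_def \<Sigma>_def power_divide)
  qed
  finally have main: "a \<le> c * (\<Sum>\<sigma>\<in>\<Sigma>. 2 * L * \<mu> \<sigma>) + \<eta>" by simp
  have "(\<Sum>\<sigma>\<in>\<Sigma>. 2 * L * \<mu> \<sigma>) = 2 * L * (\<Sum>\<sigma>\<in>\<Sigma>. max 0 (\<mu> \<sigma>)) - 2 * L * (\<Sum>\<sigma>\<in>\<Sigma>. max 0 (- \<mu> \<sigma>))"
    unfolding sum_distrib_left sum_subtractf[symmetric]
    by (rule sum.cong) (auto simp: max_def)
  with main have "a \<le> c * (2 * L * (\<Sum>\<sigma>\<in>\<Sigma>. max 0 (\<mu> \<sigma>)) - 2 * L * (\<Sum>\<sigma>\<in>\<Sigma>. max 0 (- \<mu> \<sigma>))) + \<eta>"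
    by simp
  then have main': "a + 2 * L * ((\<Sum>\<sigma>\<in>\<Sigma>. max 0 (- \<mu> \<sigma>)) * c) \<le> 2 * L * ((\<Sum>\<sigma>\<in>\<Sigma>. max 0 (\<mu> \<sigma>)) * c) + \<eta>"
    by (simp add: algebra_simps)
  \<comment> \<open>Since \<open>T\<close> is contained in \<open>G\<close>, passing from
    \<open>\<mu>\<close> to the full supremum can only enlarge the positive parts and shrink the
    negative ones, and each stands on the side where this helps.\<close>
  have \<mu>_le: "ereal (\<mu> \<sigma>) \<le> rademacher_sup N G (x, \<sigma>)" for \<sigma>
  proof -
    obtain g where "g \<in> T" "\<mu> \<sigma> = m \<sigma> g" using Max_in[of "m \<sigma> ` T"] T by (auto simp: \<mu>_def image_iff)
    then show ?thesis
      using T(3) unfolding rademacher_sup_def by (auto simp: m_def intro!: SUP_upper2[of g])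
  qed
  \<comment> \<open>\<open>ennreal\<close> sends negative reals to 0 and so takes the positive part
    implicitly.\<close>
  have sum_max: "(\<Sum>\<sigma>\<in>\<Sigma>. ennreal (\<phi> \<sigma>)) * q = ennreal ((\<Sum>\<sigma>\<in>\<Sigma>. max 0 (\<phi> \<sigma>)) * c)" for \<phi>
  proof -
    have "(\<Sum>\<sigma>\<in>\<Sigma>. ennreal (\<phi> \<sigma>)) = (\<Sum>\<sigma>\<in>\<Sigma>. ennreal (max 0 (\<phi> \<sigma>)))"
      by (rule sum.cong) (auto simp: max_def ennreal_neg)
    also have "\<dots> = ennreal (\<Sum>\<sigma>\<in>\<Sigma>. max 0 (\<phi> \<sigma>))"
      by (rule sum_ennreal) simp
    finally show ?thesis using c by (simp only: ennreal_mult sum_nonneg max.cobounded1)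
  qed
  have "ennreal a + ennreal (2 * L) * ((\<Sum>\<sigma>\<in>\<Sigma>. e2ennreal (- rademacher_sup N G (x, \<sigma>))) * q)
     \<le> ennreal a + ennreal (2 * L) * ((\<Sum>\<sigma>\<in>\<Sigma>. ennreal (- \<mu> \<sigma>)) * q)"
  proof (intro add_left_mono mult_left_mono mult_right_mono sum_mono)
    fix \<sigma>
    have "e2ennreal (- rademacher_sup N G (x, \<sigma>)) \<le> e2ennreal (- ereal (\<mu> \<sigma>))"
      using \<mu>_le by (intro e2ennreal_mono) (simp only: ereal_minus_le_minus)
    then show "e2ennreal (- rademacher_sup N G (x, \<sigma>)) \<le> ennreal (- \<mu> \<sigma>)" by simp
  qed auto
  also have "\<dots> = ennreal (a + 2 * L * ((\<Sum>\<sigma>\<in>\<Sigma>. max 0 (- \<mu> \<sigma>)) * c))"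
    unfolding sum_max using a L c
    by (subst ennreal_plus) (auto simp: ennreal_mult sum_nonneg intro!: mult_nonneg_nonneg)
  also have "\<dots> \<le> ennreal (2 * L * ((\<Sum>\<sigma>\<in>\<Sigma>. max 0 (\<mu> \<sigma>)) * c) + \<eta>)"
    using main' by (rule ennreal_leI)
  also have "\<dots> = ennreal (2 * L) * ((\<Sum>\<sigma>\<in>\<Sigma>. ennreal (\<mu> \<sigma>)) * q) + ennreal \<eta>"
    unfolding sum_max using \<eta> L c
    by (subst ennreal_plus) (auto simp: ennreal_mult sum_nonneg intro!: mult_nonneg_nonneg)
  also have "\<dots> \<le> ennreal (2 * L) * ((\<Sum>\<sigma>\<in>\<Sigma>. e2ennreal (rademacher_sup N G (x, \<sigma>))) * q) + ennreal \<eta>"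
  proof (intro add_right_mono mult_left_mono mult_right_mono sum_mono)
    fix \<sigma>
    show "ennreal (\<mu> \<sigma>) \<le> e2ennreal (rademacher_sup N G (x, \<sigma>))"
      using e2ennreal_mono[OF \<mu>_le[of \<sigma>]] by simp
  qed auto
  finally show "ennreal ((\<Sum>e\<in>sign_patterns N. SUP g\<in>G. (1 / real N) * (\<Sum>i<N. e i * w i g)) / 2 ^ N)
      + ennreal (2 * L) * ((\<Sum>\<sigma>\<in>PiE {..<N} (\<lambda>_. sign_vectors). e2ennreal (- rademacher_sup N G (x, \<sigma>))) * q)
    \<le> ennreal (2 * L) * ((\<Sum>\<sigma>\<in>PiE {..<N} (\<lambda>_. sign_vectors). e2ennreal (rademacher_sup N G (x, \<sigma>))) * q)
      + ennreal \<eta>"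
    by (simp only: a_def f_def \<Sigma>_def)
qed

text \<open>If \<open>c = 0\<close>, then \<open>a = 0\<close> and the product vanishes. If
  \<open>c > 0\<close> and \<open>p\<close> is infinite, the difference is infinity even for
  infinite \<open>n\<close>, by the convention for \<open>ereal\<close>. If \<open>p\<close> is
  finite, the assumption forces \<open>n\<close> to be finite and the claim is one about
  reals.\<close>

lemma ereal_le_mult_diff:
  assumes a: "a \<ge> 0" and c: "c \<ge> 0" and le: "ennreal a + ennreal c * n \<le> ennreal c * p"
  shows "ereal a \<le> ereal c * (enn2ereal p - enn2ereal n)"
proof (cases "c = 0")
  case True
  then have "a = 0" using le a by (simp add: ennreal_eq_0_iff)
  then show ?thesis using True by (simp flip: zero_ereal_def)
next
  case False
  then have c: "c > 0" using c by simp
  show ?thesis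
  proof (cases p rule: ennreal_cases)
    case top
    then show ?thesis using c by simp
  next
    case (real p')
    have "ennreal c * n \<le> ennreal (c * p')"
      using le real c by (metis add_increasing zero_le ennreal_mult less_imp_le order_trans le_add_same_cancel2 add.commute le_iff_add)
    then have "n \<noteq> top" using c by (auto simp: ennreal_mult_top top_unique ennreal_eq_0_iff)
    then obtain n' where n': "n' \<ge> 0" "n = ennreal n'" by (cases n rule: ennreal_cases) auto
    have "ennreal (a + c * n') \<le> ennreal (c * p')"
      using le real n' a c by (simp add: ennreal_mult)
    then have "a + c * n' \<le> c * p'"
      using real c by (simp add: ennreal_le_iff)
    then show ?thesis using real n' by (simp add: algebra_simps)
  qed
qed

section \<open>The regularized solution as a projection, and properties of the loss\<close>

text \<open>Completing the square. The subtracted term does not involve \<open>z\<close>, so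
  minimizing the objective means minimizing the distance to the scaled point.\<close>

lemma inner_reg_objective:
  fixes y z :: "real^'d"
  assumes "\<gamma> > 0"
  shows "y \<bullet> z + \<gamma> / 2 * (norm z)\<^sup>2
    = \<gamma> / 2 * (dist (- (1 / \<gamma>) *\<^sub>R y) z)\<^sup>2 - (norm y)\<^sup>2 / (2 * \<gamma>)"
proof -
  have "(dist (- (1 / \<gamma>) *\<^sub>R y) z)\<^sup>2 = (norm y)\<^sup>2 / \<gamma>\<^sup>2 + 2 / \<gamma> * (y \<bullet> z) + (norm z)\<^sup>2"
    unfolding dist_norm power2_norm_eq_inner
    by (simp add: inner_diff_left inner_diff_right inner_commute power2_eq_square)
  then show ?thesis using assms by (simp add: field_simps power2_eq_square)
qed

text \<open>The objective and the distance order the points alike, and closest points of a closed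
  convex set are unique, which gives meaning to the definite description.\<close>

lemma reg_solution_eq_closest_point:
  fixes Z :: "(real^'d) set"
  assumes \<gamma>: "\<gamma> > 0" and Z: "Z \<noteq> {}" "compact Z" "convex Z"
  shows "reg_solution Z \<gamma> y = closest_point Z (- (1 / \<gamma>) *\<^sub>R y)"
proof -
  let ?a = "- (1 / \<gamma>) *\<^sub>R y"
  have Zc: "closed Z" using Z(2) by (rule compact_imp_closed)
  have le: "y \<bullet> z + \<gamma> / 2 * (norm z)\<^sup>2 \<le> y \<bullet> z' + \<gamma> / 2 * (norm z')\<^sup>2 \<longleftrightarrow> dist ?a z \<le> dist ?a z'" for z z'
    unfolding inner_reg_objective[OF \<gamma>] using \<gamma> by (simp add: power2_le_iff_abs_le)
  show ?thesis
    unfolding reg_solution_def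
  proof (rule the_equality)
    show "is_arg_min (\<lambda>z. y \<bullet> z + \<gamma> / 2 * (norm z)\<^sup>2) (\<lambda>z. z \<in> Z) (closest_point Z ?a)"
      unfolding is_arg_min_linorder le
      using closest_point_in_set[OF Zc Z(1)] closest_point_le[OF Zc] by blast
    fix z assume "is_arg_min (\<lambda>z. y \<bullet> z + \<gamma> / 2 * (norm z)\<^sup>2) (\<lambda>z. z \<in> Z) z"
    then show "z = closest_point Z ?a"
      unfolding is_arg_min_linorder le using closest_point_unique[OF Z(3) Zc] by blast
  qed
qed

lemma reg_solution_in:
  fixes Z :: "(real^'d) set"
  assumes "\<gamma> > 0" "Z \<noteq> {}" "compact Z" "convex Z"
  shows "reg_solution Z \<gamma> y \<in> Z"
  using assms by (simp add: reg_solution_eq_closest_point closest_point_in_set compact_imp_closed)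

text \<open>Projection onto a closed convex set is nonexpansive, and the projected point depends on
  \<open>y\<close> through the factor \<open>- 1 / \<gamma>\<close>.\<close>

lemma reg_solution_lipschitz:
  fixes Z :: "(real^'d) set"
  assumes "\<gamma> > 0" "Z \<noteq> {}" "compact Z" "convex Z"
  shows "norm (reg_solution Z \<gamma> y - reg_solution Z \<gamma> y') \<le> norm (y - y') / \<gamma>"
proof -
  have "norm (reg_solution Z \<gamma> y - reg_solution Z \<gamma> y') \<le> dist (- (1 / \<gamma>) *\<^sub>R y) (- (1 / \<gamma>) *\<^sub>R y')"
    using closest_point_lipschitz[of Z] assms
    by (simp add: reg_solution_eq_closest_point compact_imp_closed flip: dist_norm)
  also have "\<dots> = norm ((- (1 / \<gamma>)) *\<^sub>R (y - y'))"
    by (simp only: dist_norm scaleR_diff_right)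
  also have "\<dots> = norm (y - y') / \<gamma>"
    using assms(1) by (simp only: norm_scaleR) simp
  finally show ?thesis .
qed

lemma compact_inner_bdd:
  fixes Z :: "(real^'d) set"
  assumes "compact Z"
  shows "bdd_below ((\<lambda>z. y \<bullet> z) ` Z)" "bdd_above ((\<lambda>z. y \<bullet> z) ` Z)"
proof -
  have "compact ((\<lambda>z. y \<bullet> z) ` Z)"
    by (intro compact_continuous_image assms continuous_intros)
  then show "bdd_below ((\<lambda>z. y \<bullet> z) ` Z)" "bdd_above ((\<lambda>z. y \<bullet> z) ` Z)"
    by (auto intro: bounded_imp_bdd_below bounded_imp_bdd_above compact_imp_bounded)
qed

text \<open>An infimum of linear functions that share the Lipschitz constant \<open>B\<close>, a
  norm bound for \<open>Z\<close>. Continuity is what makes the loss measurable.\<close>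

lemma opt_value_continuous:
  fixes Z :: "(real^'d) set"
  assumes Z: "Z \<noteq> {}" "compact Z"
  shows "continuous_on UNIV (opt_value Z)"
proof -
  obtain B where B: "B > 0" "\<And>z. z \<in> Z \<Longrightarrow> norm z \<le> B"
    using compact_imp_bounded[OF Z(2)] by (auto simp: bounded_pos)
  have le: "opt_value Z y \<le> opt_value Z y' + B * dist y y'" for y y'
  proof -
    have "opt_value Z y - B * dist y y' \<le> opt_value Z y'"
      unfolding opt_value_def[of Z y']
    proof (rule cINF_greatest[OF Z(1)])
      fix z assume z: "z \<in> Z"
      have "opt_value Z y \<le> y \<bullet> z"
        unfolding opt_value_def using compact_inner_bdd[OF Z(2)] z by (intro cINF_lower)
      also have "y \<bullet> z = y' \<bullet> z + (y - y') \<bullet> z" by (simp add: inner_diff_left)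
      also have "(y - y') \<bullet> z \<le> norm (y - y') * norm z" by (rule norm_cauchy_schwarz)
      also have "\<dots> \<le> norm (y - y') * B" using B(2)[OF z] by (rule mult_left_mono) simp
      finally show "opt_value Z y - B * dist y y' \<le> y' \<bullet> z" by (simp add: dist_norm mult.commute)
    qed
    then show ?thesis by simp
  qed
  have "B-lipschitz_on UNIV (opt_value Z)"
  proof (rule lipschitz_onI)
    fix y y'
    show "dist (opt_value Z y) (opt_value Z y') \<le> B * dist y y'"
      using le[of y y'] le[of y' y] by (simp add: dist_real_def abs_le_iff dist_commute)
  qed (use B in simp)
  then show ?thesis by (rule lipschitz_on_continuous_on)
qed

lemma rspo_loss_range:
  fixes Z :: "(real^'d) set"
  assumes "\<gamma> > 0" and Z: "Z \<noteq> {}" "compact Z" "convex Z"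
  shows "0 \<le> rspo_loss Z \<gamma> yhat y" "rspo_loss Z \<gamma> yhat y \<le> cost_range Z y"
proof -
  have z: "reg_solution Z \<gamma> yhat \<in> Z" by (rule reg_solution_in[OF assms])
  have "opt_value Z y \<le> y \<bullet> reg_solution Z \<gamma> yhat"
    unfolding opt_value_def using compact_inner_bdd[OF Z(2)] z by (intro cINF_lower)
  then show "0 \<le> rspo_loss Z \<gamma> yhat y" by (simp add: rspo_loss_def)
  have "y \<bullet> reg_solution Z \<gamma> yhat \<le> (SUP z\<in>Z. y \<bullet> z)"
    using compact_inner_bdd[OF Z(2)] z by (intro cSUP_upper)
  then show "rspo_loss Z \<gamma> yhat y \<le> cost_range Z y"
    by (simp add: rspo_loss_def cost_range_def opt_value_def)
qed

lemma rspo_loss_lipschitz: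
  fixes Z :: "(real^'d) set"
  assumes \<gamma>: "\<gamma> > 0" and Z: "Z \<noteq> {}" "compact Z" "convex Z" and y: "norm y \<le> r"
  shows "\<bar>rspo_loss Z \<gamma> a y - rspo_loss Z \<gamma> a' y\<bar> \<le> r / \<gamma> * norm (a - a')"
proof -
  have "\<bar>rspo_loss Z \<gamma> a y - rspo_loss Z \<gamma> a' y\<bar> = \<bar>y \<bullet> (reg_solution Z \<gamma> a - reg_solution Z \<gamma> a')\<bar>"
    by (simp add: rspo_loss_def inner_diff_right)
  also have "\<dots> \<le> norm y * norm (reg_solution Z \<gamma> a - reg_solution Z \<gamma> a')"
    by (rule Cauchy_Schwarz_ineq2)
  also have "\<dots> \<le> r * (norm (a - a') / \<gamma>)"
    using y order_trans[OF norm_ge_zero y] by (intro mult_mono reg_solution_lipschitz \<gamma> Z) auto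
  finally show ?thesis by simp
qed

lemma rspo_loss_measurable:
  fixes Z :: "(real^'d) set"
  assumes \<gamma>: "\<gamma> > 0" and Z: "Z \<noteq> {}" "compact Z" "convex Z"
    and f: "f \<in> borel_measurable M" and h: "h \<in> borel_measurable M"
  shows "(\<lambda>x. rspo_loss Z \<gamma> (f x) (h x)) \<in> borel_measurable M"
proof -
  have "closest_point Z \<in> borel_measurable borel"
    using Z by (intro borel_measurable_continuous_onI continuous_on_closest_point compact_imp_closed)
  then have "reg_solution Z \<gamma> \<in> borel_measurable borel"
    unfolding reg_solution_eq_closest_point[OF \<gamma> Z, abs_def] by measurable
  moreover have "opt_value Z \<in> borel_measurable borel"
    using opt_value_continuous[OF Z(1,2)] by (rule borel_measurable_continuous_onI)
  ultimately show ?thesis unfolding rspo_loss_def using f h by measurable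
qed

section \<open>Comparison of the two Rademacher complexities\<close>

text \<open>The contraction for a fixed sample is integrated over the sample. The losses live on
  pairs and the predictors on inputs, so the sample of inputs is realized as the image of the sample
  of pairs under \<open>fst\<close>.\<close>

lemma rad_le_rademacher_complexity:
  fixes P :: "((real^'p) \<times> (real^'d)) measure" and G :: "(real^'p \<Rightarrow> real^'d) set"
  assumes bc: "bounded_class P G u b N"
    and fst: "fst \<in> P \<rightarrow>\<^sub>M restrict_space borel X"
    and meas: "rademacher_sup N G \<in> borel_measurable (rademacher_space N (input_law X P))"
    and L: "L \<ge> 0"
    and lip: "\<And>g g' s. g \<in> G \<Longrightarrow> g' \<in> G \<Longrightarrow> s \<in> space P \<Longrightarrow>
      \<bar>u g s - u g' s\<bar> \<le> L * norm (g (fst s) - g' (fst s))"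
  shows "ereal (bounded_class.rad P G u N) \<le> ereal (2 * L) * rademacher_complexity N (input_law X P) G"
proof -
  interpret C: bounded_class P G u b N by fact
  define D where "D = input_law X P"
  define U where "U = uniform_count_measure (sign_vectors :: (real^'d) set)"
  define \<Sigma> :: "(nat \<Rightarrow> real^'d) set" where "\<Sigma> = PiE {..<N} (\<lambda>_. sign_vectors)"
  define q where "q = ennreal (1 / card (sign_vectors :: (real^'d) set)) ^ N"
  let ?DN = "PiM {..<N} (\<lambda>_. D)" and ?UN = "PiM {..<N} (\<lambda>_. U)"
  let ?x = "compose {..<N} fst :: (nat \<Rightarrow> (real^'p) \<times> (real^'d)) \<Rightarrow> nat \<Rightarrow> real^'p"
  let ?Q = "rademacher_sup N G"
  have RS: "rademacher_space N D = ?DN \<Otimes>\<^sub>M ?UN"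
    by (simp add: rademacher_space_def U_def)
  have fstD: "fst \<in> P \<rightarrow>\<^sub>M D"
    using fst by (simp add: D_def input_law_def)
  have D: "prob_space D" unfolding D_def input_law_def by (rule C.prob_space_distr[OF fst])
  have U: "prob_space U" unfolding U_def
    by (intro prob_space_uniform_count_measure finite_sign_vectors sign_vectors_nonempty)
  interpret UN: prob_space ?UN by (intro prob_space_PiM U)
  have x_meas: "?x \<in> C.S \<rightarrow>\<^sub>M ?DN"
    unfolding compose_def
    by (intro measurable_restrict measurable_compose[OF _ fstD] measurable_component_singleton)
  have "distr P D fst = D"
    by (simp add: D_def input_law_def cong: distr_cong)
  then have distr_x: "distr C.S ?DN ?x = ?DN"
    using distr_PiM_finite_prob_space'[of "{..<N}" "\<lambda>_. P" "\<lambda>_. D" fst] C.prob_space_axioms D fstD by simp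
  have space_UN: "space ?UN = \<Sigma>"
    by (simp add: space_PiM U_def space_uniform_count_measure \<Sigma>_def)
  have sec: "(\<lambda>s. h (?x s, \<sigma>)) \<in> borel_measurable C.S"
    if h: "h \<in> borel_measurable (?DN \<Otimes>\<^sub>M ?UN)" and "\<sigma> \<in> \<Sigma>" for h :: "_ \<Rightarrow> ennreal" and \<sigma>
    using measurable_compose[OF x_meas measurable_compose[OF measurable_Pair2' h]] that space_UN by simp
  \<comment> \<open>Rewrites an expectation over inputs and signs as one over the sample of pairs of
    a finite average over the signs, the shape in which the pointwise bound is available.\<close>
  have int: "(\<integral>\<^sup>+p. h p \<partial>(?DN \<Otimes>\<^sub>M ?UN)) = (\<integral>\<^sup>+s. (\<Sum>\<sigma>\<in>\<Sigma>. h (?x s, \<sigma>)) * q \<partial>C.S)"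
    if h: "h \<in> borel_measurable (?DN \<Otimes>\<^sub>M ?UN)" for h
  proof -
    have "(\<integral>\<^sup>+p. h p \<partial>(?DN \<Otimes>\<^sub>M ?UN)) = (\<integral>\<^sup>+x. (\<integral>\<^sup>+\<sigma>. h (x, \<sigma>) \<partial>?UN) \<partial>?DN)"
      by (rule UN.nn_integral_fst[OF h, symmetric])
    also have "\<dots> = (\<integral>\<^sup>+x. (\<Sum>\<sigma>\<in>\<Sigma>. h (x, \<sigma>)) * q \<partial>?DN)"
    proof (rule nn_integral_cong)
      fix x assume "x \<in> space ?DN"
      then have "(\<lambda>\<sigma>. h (x, \<sigma>)) \<in> borel_measurable ?UN"
        using h by (rule measurable_compose[OF measurable_Pair1'])
      then show "(\<integral>\<^sup>+\<sigma>. h (x, \<sigma>) \<partial>?UN) = (\<Sum>\<sigma>\<in>\<Sigma>. h (x, \<sigma>)) * q"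
        unfolding U_def \<Sigma>_def q_def
        by (subst nn_integral_PiM_uniform_count_measure)
           (auto simp: finite_sign_vectors sign_vectors_nonempty)
    qed
    also have "\<dots> = (\<integral>\<^sup>+x. (\<Sum>\<sigma>\<in>\<Sigma>. h (x, \<sigma>)) * q \<partial>distr C.S ?DN ?x)"
      by (simp only: distr_x)
    also have "\<dots> = (\<integral>\<^sup>+s. (\<Sum>\<sigma>\<in>\<Sigma>. h (?x s, \<sigma>)) * q \<partial>C.S)"
    proof (rule nn_integral_distr[OF x_meas])
      have "(\<lambda>x. h (x, \<sigma>)) \<in> borel_measurable ?DN" if "\<sigma> \<in> \<Sigma>" for \<sigma>
        using measurable_compose[OF measurable_Pair2' h] that space_UN by simp
      then have "(\<lambda>x. (\<Sum>\<sigma>\<in>\<Sigma>. h (x, \<sigma>)) * q) \<in> borel_measurable ?DN"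
        by (intro borel_measurable_times_ennreal borel_measurable_sum) auto
      then show "(\<lambda>x. (\<Sum>\<sigma>\<in>\<Sigma>. h (x, \<sigma>)) * q) \<in> borel_measurable (distr C.S ?DN ?x)"
        by simp
    qed
    finally show ?thesis .
  qed
  have Q: "?Q \<in> borel_measurable (?DN \<Otimes>\<^sub>M ?UN)" using meas by (simp add: RS flip: D_def)
  let ?h = "\<lambda>p. e2ennreal (?Q p)" and ?k = "\<lambda>p. e2ennreal (- ?Q p)"
  have h: "?h \<in> borel_measurable (?DN \<Otimes>\<^sub>M ?UN)" and k: "?k \<in> borel_measurable (?DN \<Otimes>\<^sub>M ?UN)"
    using Q by measurable
  define a where "a s = (\<Sum>e\<in>sign_patterns N. C.signed_sup e s) / 2 ^ N" for s
  have a_int: "integrable C.S a"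
    unfolding a_def[abs_def] using C.signed_sup_integrable by auto
  have a_nonneg: "a s \<ge> 0" if "s \<in> space C.S" for s
    unfolding a_def using C.sum_signed_sup_nonneg[OF that] by simp
  have rad: "(\<integral>\<^sup>+s. ennreal (a s) \<partial>C.S) = ennreal C.rad"
    unfolding C.rad_eq a_def[symmetric] using a_int a_nonneg by (intro nn_integral_eq_integral AE_I2)
  have pt: "ennreal (a s) + ennreal (2 * L) * ((\<Sum>\<sigma>\<in>\<Sigma>. ?k (?x s, \<sigma>)) * q)
      \<le> ennreal (2 * L) * ((\<Sum>\<sigma>\<in>\<Sigma>. ?h (?x s, \<sigma>)) * q)" if s: "s \<in> space C.S" for s
    unfolding a_def C.signed_sup_def C.signed_mean_def \<Sigma>_def q_def
  proof (rule contraction_rademacher_sup[OF C.G L])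
    show "\<bar>u g (s i) - u g' (s i)\<bar> \<le> L * norm (g (?x s i) - g' (?x s i))"
      if "i < N" "g \<in> G" "g' \<in> G" for i g g'
      using lip[OF that(2,3) C.component_space[OF s that(1)]] that(1) by (simp add: compose_def)
    show "bdd_above ((\<lambda>g. 1 / real N * (\<Sum>i<N. e i * u g (s i))) ` G)" if "e \<in> sign_patterns N" for e
      using C.signed_mean_bdd[OF that s] by (simp add: C.signed_mean_def)
    show "0 \<le> (\<Sum>e\<in>sign_patterns N. SUP g\<in>G. 1 / real N * (\<Sum>i<N. e i * u g (s i)))"
      using C.sum_signed_sup_nonneg[OF s] by (simp add: C.signed_sup_def C.signed_mean_def)
  qed
  have sum_meas: "(\<lambda>s. (\<Sum>\<sigma>\<in>\<Sigma>. f (?x s, \<sigma>)) * q) \<in> borel_measurable C.S"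
    if "f \<in> borel_measurable (?DN \<Otimes>\<^sub>M ?UN)" for f
    using sec[OF that] by (intro borel_measurable_times_ennreal borel_measurable_sum) auto
  \<comment> \<open>The integral of the negative part stays on the left until both integrals are
    identified, so that no difference of possibly infinite quantities arises before the last
    step.\<close>
  have "ennreal C.rad + ennreal (2 * L) * (\<integral>\<^sup>+p. ?k p \<partial>(?DN \<Otimes>\<^sub>M ?UN))
      = (\<integral>\<^sup>+s. ennreal (a s) + ennreal (2 * L) * ((\<Sum>\<sigma>\<in>\<Sigma>. ?k (?x s, \<sigma>)) * q) \<partial>C.S)"
    unfolding rad[symmetric] int[OF k] using sum_meas[OF k] borel_measurable_integrable[OF a_int]
    by (subst nn_integral_cmult[symmetric]) (auto intro!: nn_integral_add[symmetric])
  also have "\<dots> \<le> (\<integral>\<^sup>+s. ennreal (2 * L) * ((\<Sum>\<sigma>\<in>\<Sigma>. ?h (?x s, \<sigma>)) * q) \<partial>C.S)"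
    by (rule nn_integral_mono[OF pt])
  also have "\<dots> = ennreal (2 * L) * (\<integral>\<^sup>+p. ?h p \<partial>(?DN \<Otimes>\<^sub>M ?UN))"
    unfolding int[OF h] using sum_meas[OF h] by (rule nn_integral_cmult)
  finally show ?thesis
    unfolding rademacher_complexity_def ereal_expectation_def D_def[symmetric] RS
    using L C.rad_nonneg by (intro ereal_le_mult_diff) auto
qed

section \<open>Excess risk of the empirical minimizer\<close>

theorem theorem3:
  fixes X :: "(real^'p) set" and Y Z :: "(real^'d) set"
    and P :: "((real^'p) \<times> (real^'d)) measure"
    and G :: "(real^'p \<Rightarrow> real^'d) set"
    and M :: "'w measure" and S :: "nat \<Rightarrow> 'w \<Rightarrow> (real^'p) \<times> (real^'d)"
    and ghat :: "'w \<Rightarrow> real^'p \<Rightarrow> real^'d"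
    and N :: nat and r \<gamma> \<delta> :: real
  assumes "\<gamma> > 0"
    and "Z \<noteq> {}" and "compact Z" and "convex Z"
    and "\<forall>y\<in>Y. norm y \<le> r"
    and "bdd_above (cost_range Z ` Y)"
    and "prob_space P"
    and "sets P = sets (restrict_space borel X \<Otimes>\<^sub>M restrict_space borel Y)"
    and "\<forall>g\<in>G. g \<in> borel_measurable (restrict_space borel X)"
    and "measurable_suprema Z \<gamma> N X P G"
    and "N \<ge> 1"
    and "prob_space M"
    and "prob_space.indep_vars M (\<lambda>_. P) S {..<N}"
    and "\<forall>i<N. distr M P (S i) = P"
    and "\<forall>\<omega>\<in>space M. is_arg_min (emp_risk Z \<gamma> N (\<lambda>i. S i \<omega>)) (\<lambda>g. g \<in> G) (ghat \<omega>)"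
    and "0 < \<delta>" and "\<delta> < 1"
  shows "holds_with_prob_at_least M (1 - \<delta>) (\<lambda>\<omega>.
           ereal (risk Z \<gamma> P (ghat \<omega>) - best_risk Z \<gamma> P G)
           \<le> ereal (4 * sqrt 2 * r / \<gamma>) * rademacher_complexity N (input_law X P) G
             + ereal (loss_bound Z Y * sqrt (2 * ln (2 / \<delta>) / real N)))"
proof -
  interpret P: prob_space P by fact
  interpret M: prob_space M by fact
  note Z = assms(2-4)
  define u where "u g xy = rspo_loss Z \<gamma> (g (fst xy)) (snd xy)"
    for g :: "real^'p \<Rightarrow> real^'d" and xy :: "(real^'p) \<times> (real^'d)"
  have space_P: "space P = X \<times> Y"
    using sets_eq_imp_space_eq[OF assms(8)] by (simp add: space_pair_measure space_restrict_space)
  have fst: "fst \<in> P \<rightarrow>\<^sub>M restrict_space borel X"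
    using assms(8) by (simp cong: measurable_cong_sets)
  have "snd \<in> P \<rightarrow>\<^sub>M restrict_space borel Y"
    using assms(8) by (simp cong: measurable_cong_sets)
  then have snd: "snd \<in> borel_measurable P"
    by (simp add: measurable_restrict_space2_iff)
  have argmin: "ghat \<omega> \<in> G" "\<And>g. g \<in> G \<Longrightarrow> emp_risk Z \<gamma> N (\<lambda>i. S i \<omega>) (ghat \<omega>) \<le> emp_risk Z \<gamma> N (\<lambda>i. S i \<omega>) g"
    if "\<omega> \<in> space M" for \<omega>
    using assms(15) that by (auto simp: is_arg_min_linorder)
  have bc: "bounded_class P G u (loss_bound Z Y) N"
  proof
    show "1 \<le> N" by fact
    show "G \<noteq> {}" using argmin(1) M.not_empty by auto
    show "u g \<in> borel_measurable P" if "g \<in> G" for g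
      unfolding u_def using assms(9) that
      by (intro rspo_loss_measurable[OF assms(1) Z] measurable_compose[OF fst] snd) auto
    show "0 \<le> u g xy \<and> u g xy \<le> loss_bound Z Y" if "xy \<in> space P" for g xy
    proof -
      have "cost_range Z (snd xy) \<le> loss_bound Z Y"
        unfolding loss_bound_def using that assms(6) space_P by (intro cSUP_upper) (simp_all add: mem_Times_iff)
      then show ?thesis
        unfolding u_def
        using rspo_loss_range[OF assms(1) Z, where yhat = "g (fst xy)" and y = "snd xy"] by simp
    qed
    show "(\<lambda>s. SUP g\<in>G. ereal (1 / real N * (\<Sum>i<N. e i * u g (s i)))) \<in> borel_measurable (PiM {..<N} (\<lambda>_. P))"
      if "e \<in> sign_patterns N" for e
      using assms(10) that unfolding measurable_suprema_def sign_patterns_def u_def by blast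
  qed
  interpret C: bounded_class P G u "loss_bound Z Y" N by (rule bc)
  \<comment> \<open>A probability space is nonempty, so \<open>Y\<close> contains a point and
    \<open>r\<close> bounds a norm.\<close>
  obtain xy where "xy \<in> space P" using P.not_empty by blast
  then have "norm (snd xy) \<le> r" using assms(5) space_P by auto
  then have r: "r \<ge> 0" using order_trans[OF norm_ge_zero] by blast
  let ?RC = "rademacher_complexity N (input_law X P) G"
  have "ereal C.rad \<le> ereal (2 * (r / \<gamma>)) * ?RC"
  proof (rule rad_le_rademacher_complexity[OF bc fst])
    show "rademacher_sup N G \<in> borel_measurable (rademacher_space N (input_law X P))"
      using assms(10) by (simp add: measurable_suprema_def)
    show "r / \<gamma> \<ge> 0" using r assms(1) by simp
    show "\<bar>u g s - u g' s\<bar> \<le> r / \<gamma> * norm (g (fst s) - g' (fst s))" if "s \<in> space P" for g g' s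
      unfolding u_def using assms(5) that space_P by (intro rspo_loss_lipschitz[OF assms(1) Z]) auto
  qed
  \<comment> \<open>The factor \<open>sqrt 2\<close> of the claimed constant is introduced on the
    side of \<open>C.rad\<close>, whose nonnegativity then gives the bound for
    \<open>2 * C.rad\<close>.\<close>
  then have "ereal (2 * sqrt 2) * ereal C.rad \<le> ereal (2 * sqrt 2) * (ereal (2 * (r / \<gamma>)) * ?RC)"
    by (intro ereal_mult_left_mono) auto
  also have "\<dots> = ereal (4 * sqrt 2 * r / \<gamma>) * ?RC"
    by (simp add: mult.assoc[symmetric])
  finally have rad2: "ereal (2 * sqrt 2 * C.rad) \<le> ereal (4 * sqrt 2 * r / \<gamma>) * ?RC" by simp
  have "2 * C.rad \<le> 2 * sqrt 2 * C.rad"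
    using C.rad_nonneg by (intro mult_right_mono) auto
  then have "ereal (2 * C.rad) \<le> ereal (2 * sqrt 2 * C.rad)" by simp
  from order_trans[OF this rad2] have rad: "ereal (2 * C.rad) \<le> ereal (4 * sqrt 2 * r / \<gamma>) * ?RC" .
  obtain A where A: "A \<in> sets C.S" "measure C.S A \<ge> 1 - \<delta>"
    and A_le: "\<And>s g. s \<in> A \<Longrightarrow> g \<in> G \<Longrightarrow> (\<And>g'. g' \<in> G \<Longrightarrow> (\<Sum>i<N. u g (s i)) \<le> (\<Sum>i<N. u g' (s i))) \<Longrightarrow>
      (\<integral>x. u g x \<partial>P) - (INF g\<in>G. \<integral>x. u g x \<partial>P) \<le> 2 * C.rad + loss_bound Z Y * sqrt (2 * ln (2 / \<delta>) / N)"
    using C.excess_risk_bound[OF assms(16,17)] by blast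
  let ?s = "\<lambda>\<omega>. \<lambda>i\<in>{..<N}. S i \<omega>"
  have S: "S i \<in> M \<rightarrow>\<^sub>M P" if "i < N" for i
    using assms(13) that by (auto simp: M.indep_vars_def)
  have s_meas: "?s \<in> M \<rightarrow>\<^sub>M C.S"
    using S by (intro measurable_restrict) auto
  \<comment> \<open>Independence and the common law \<open>P\<close> make the restricted sample
    distributed as the product measure, so the event found there can be pulled back to
    \<open>M\<close>.\<close>
  have "distr M C.S ?s = PiM {..<N} (\<lambda>i. distr M P (S i))"
    using M.indep_vars_iff_distr_eq_PiM'[where I = "{..<N}" and M' = "\<lambda>_. P" and X = S] assms(11,13) S by (auto simp: lessThan_empty_iff)
  also have "\<dots> = C.S"
    using assms(14) by (intro PiM_cong) auto
  finally have distr: "distr M C.S ?s = C.S" .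
  \<comment> \<open>The event depends on the sample alone and not on \<open>ghat\<close>, hence is
    measurable whatever selection \<open>ghat\<close> makes.\<close>
  define B where "B = ?s -` A \<inter> space M"
  have "B \<in> sets M" unfolding B_def using s_meas A(1) by (rule measurable_sets)
  moreover have "measure M B \<ge> 1 - \<delta>"
    using measure_distr[OF s_meas A(1)] A(2) by (simp add: distr B_def)
  moreover have "ereal (risk Z \<gamma> P (ghat \<omega>) - best_risk Z \<gamma> P G)
      \<le> ereal (4 * sqrt 2 * r / \<gamma>) * ?RC + ereal (loss_bound Z Y * sqrt (2 * ln (2 / \<delta>) / real N))"
    if \<omega>: "\<omega> \<in> B" for \<omega>
  proof -
    have \<omega>M: "\<omega> \<in> space M" and sA: "?s \<omega> \<in> A" using \<omega> by (auto simp: B_def)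
    have "(\<Sum>i<N. u (ghat \<omega>) (?s \<omega> i)) \<le> (\<Sum>i<N. u g (?s \<omega> i))" if "g \<in> G" for g
      using argmin(2)[OF \<omega>M that] assms(11) by (simp add: emp_risk_def u_def divide_le_cancel)
    then have "risk Z \<gamma> P (ghat \<omega>) - best_risk Z \<gamma> P G
        \<le> 2 * C.rad + loss_bound Z Y * sqrt (2 * ln (2 / \<delta>) / N)"
      using A_le[OF sA argmin(1)[OF \<omega>M]] by (simp add: risk_def best_risk_def u_def)
    then have "ereal (risk Z \<gamma> P (ghat \<omega>) - best_risk Z \<gamma> P G)
        \<le> ereal (2 * C.rad) + ereal (loss_bound Z Y * sqrt (2 * ln (2 / \<delta>) / N))"
      by simp
    also have "\<dots> \<le> ereal (4 * sqrt 2 * r / \<gamma>) * ?RC + ereal (loss_bound Z Y * sqrt (2 * ln (2 / \<delta>) / N))"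
      by (rule add_right_mono[OF rad])
    finally show ?thesis .
  qed
  ultimately show ?thesis
    unfolding holds_with_prob_at_least_def by blast
qed

end
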